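(* Let $n\ge 1$. For any integers $i\ge 0$ and $j>0$, the pair $\mathcal{O}_{\mathbb{P}^n}(i),\mathcal{O}_{\mathbb{P}^n}(i+j)$ is strongly Kronecker stable, i.e. $\mathcal{O}_{\mathbb{P}^n}(i)<\mathcal{O}_{\mathbb{P}^n}(i+j)$.
   Context: $\mathbb{P}^n$ is projective space over $\mathbb{C}$. A pair $E_1,E_2$ of coherent sheaves on $\mathbb{P}^n$ is called strongly Kronecker stable, written $E_1<E_2$, if: (a) $H^0(E_2)\ne 0$; (b) the evaluation map $\operatorname{ev}:H^0(E_1)\otimes\operatorname{Hom}(E_1,E_2)\to H^0(E_2)$ is surjective; and (c) for every subspace $0\ne V\subsetneq H^0(E_1)$, $$\frac{\dim \operatorname{ev}(V\otimes\operatorname{Hom}(E_1,E_2))}{h^0(E_2)}>\frac{\dim V}{h^0(E_1)}.$$ *)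

theory Defs
  imports
    Complex_Main
    "HOL-Library.Poly_Mapping"
    "Jordan_Normal_Form.Missing_VectorSpace"
begin

section \<open>Projective space with its Zariski topology\<close>

text \<open>
  The space \<open>P\<^sup>n\<close> is treated as a classical complex variety: its points are the closed points,
  and sheaves are sheaves on the Zariski topology of that variety. Vectors of
  \<open>\<complex>\<^sup>n\<^sup>+\<^sup>1\<close> have coordinates \<open>x 0, \<dots>, x n\<close> and are \<open>0\<close> beyond. A point is a
  line through the origin with the origin removed, so for a set \<open>U\<close> of points,
  \<open>\<Union>U\<close> is the (punctured) affine cone over \<open>U\<close>.
\<close>

type_synonym vec = "nat \<Rightarrow> complex"
type_synonym point = "vec set"
type_synonym mpoly = "(nat \<Rightarrow>\<^sub>0 nat) \<Rightarrow>\<^sub>0 complex"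

definition punctured_space :: "nat \<Rightarrow> vec set" where
  "punctured_space n = {x. (\<forall>k>n. x k = 0) \<and> (\<exists>k. x k \<noteq> 0)}"

definition point_of :: "vec \<Rightarrow> point" where
  "point_of x = {\<lambda>k. c * x k | c. c \<noteq> 0}"

definition proj_space :: "nat \<Rightarrow> point set" where
  "proj_space n = point_of ` punctured_space n"

definition mpoly_eval :: "mpoly \<Rightarrow> vec \<Rightarrow> complex" where
  "mpoly_eval p x =
     (\<Sum>m\<in>Poly_Mapping.keys p. Poly_Mapping.lookup p m *
        (\<Prod>k\<in>Poly_Mapping.keys m. x k ^ Poly_Mapping.lookup m k))"

text \<open>Homogeneous of degree \<open>e\<close> in the variables \<open>x 0, \<dots>, x n\<close>; this includes the zero polynomial.\<close>

definition homogeneous :: "nat \<Rightarrow> nat \<Rightarrow> mpoly \<Rightarrow> bool" where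
  "homogeneous n e p \<longleftrightarrow>
     (\<forall>m\<in>Poly_Mapping.keys p. Poly_Mapping.keys m \<subseteq> {..n} \<and>
        (\<Sum>k\<in>Poly_Mapping.keys m. Poly_Mapping.lookup m k) = e)"

text \<open>Open sets are the complements of common zero loci of sets of homogeneous polynomials.\<close>

definition zariski_open :: "nat \<Rightarrow> point set \<Rightarrow> bool" where
  "zariski_open n U \<longleftrightarrow>
     (\<exists>S. (\<forall>p\<in>S. \<exists>e. homogeneous n e p) \<and>
          U = proj_space n - {P \<in> proj_space n. \<forall>p\<in>S. \<forall>x\<in>P. mpoly_eval p x = 0})"


section \<open>The structure sheaf and the sheaves \<open>\<O>(d)\<close>\<close>

text \<open>
  Sections of \<open>\<O>(d)\<close> over \<open>U\<close> are the functions on the cone over \<open>U\<close> that are locally on \<open>U\<close>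
  quotients \<open>p/q\<close> of homogeneous polynomials with \<open>deg p - deg q = d\<close>, the denominator having no
  zero. For \<open>d = 0\<close> such a function is constant on each line, i.e. it is a regular function on \<open>U\<close>.
  Functions are extensional (\<open>undefined\<close> off the cone), so that equality of sections is equality
  in HOL.
\<close>

definition twist_sections :: "nat \<Rightarrow> int \<Rightarrow> point set \<Rightarrow> (vec \<Rightarrow> complex) set" where
  "twist_sections n d U =
     {f \<in> extensional (\<Union>U). \<forall>P\<in>U. \<exists>V p q a b.
        zariski_open n V \<and> P \<in> V \<and> V \<subseteq> U \<and>
        homogeneous n a p \<and> homogeneous n b q \<and> int a - int b = d \<and>
        (\<forall>x\<in>\<Union>V. mpoly_eval q x \<noteq> 0 \<and> f x = mpoly_eval p x / mpoly_eval q x)}"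

definition structure_ring :: "nat \<Rightarrow> point set \<Rightarrow> (vec \<Rightarrow> complex) ring" where
  "structure_ring n U =
     \<lparr>carrier = twist_sections n 0 U,
      mult = (\<lambda>f g. \<lambda>x\<in>\<Union>U. f x * g x),
      one = (\<lambda>x\<in>\<Union>U. 1),
      zero = (\<lambda>x\<in>\<Union>U. 0),
      add = (\<lambda>f g. \<lambda>x\<in>\<Union>U. f x + g x)\<rparr>"

definition structure_restr :: "point set \<Rightarrow> (vec \<Rightarrow> complex) \<Rightarrow> (vec \<Rightarrow> complex)" where
  "structure_restr V f = restrict f (\<Union>V)"

record 's mod_sheaf =
  sections :: "point set \<Rightarrow> (vec \<Rightarrow> complex, 's) module"
  restr :: "point set \<Rightarrow> point set \<Rightarrow> 's \<Rightarrow> 's"  \<comment> \<open>\<open>restr F U V\<close> restricts from \<open>U\<close> to \<open>V\<close>\<close>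

text \<open>
  The fields \<^const>\<open>mult\<close> and \<^const>\<open>one\<close> of a module record carry no meaning.
\<close>

definition twist :: "nat \<Rightarrow> int \<Rightarrow> (vec \<Rightarrow> complex) mod_sheaf" where
  "twist n d =
     \<lparr>sections = (\<lambda>U.
        \<lparr>carrier = twist_sections n d U,
         mult = undefined,
         one = undefined,
         zero = (\<lambda>x\<in>\<Union>U. 0),
         add = (\<lambda>f g. \<lambda>x\<in>\<Union>U. f x + g x),
         smult = (\<lambda>r f. \<lambda>x\<in>\<Union>U. r x * f x)\<rparr>),
      restr = (\<lambda>U V f. restrict f (\<Union>V))\<rparr>"


section \<open>Coherent sheaves and their morphisms\<close>

abbreviation sec :: "'s mod_sheaf \<Rightarrow> point set \<Rightarrow> 's set" where
  "sec F U \<equiv> carrier (sections F U)"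

locale sheaf_of_modules =
  fixes n :: nat and F :: "'s mod_sheaf"
  assumes module_sections:
      "zariski_open n U \<Longrightarrow> Module.module (structure_ring n U) (sections F U)"
    and restr_closed:
      "\<lbrakk>zariski_open n U; zariski_open n V; V \<subseteq> U; s \<in> sec F U\<rbrakk> \<Longrightarrow> restr F U V s \<in> sec F V"
    and restr_add:
      "\<lbrakk>zariski_open n U; zariski_open n V; V \<subseteq> U; s \<in> sec F U; t \<in> sec F U\<rbrakk> \<Longrightarrow>
        restr F U V (s \<oplus>\<^bsub>sections F U\<^esub> t) = restr F U V s \<oplus>\<^bsub>sections F V\<^esub> restr F U V t"
    and restr_smult:
      "\<lbrakk>zariski_open n U; zariski_open n V; V \<subseteq> U; r \<in> carrier (structure_ring n U); s \<in> sec F U\<rbrakk> \<Longrightarrow>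
        restr F U V (r \<odot>\<^bsub>sections F U\<^esub> s) = structure_restr V r \<odot>\<^bsub>sections F V\<^esub> restr F U V s"
    and restr_id:
      "\<lbrakk>zariski_open n U; s \<in> sec F U\<rbrakk> \<Longrightarrow> restr F U U s = s"
    and restr_restr:
      "\<lbrakk>zariski_open n U; zariski_open n V; zariski_open n W; W \<subseteq> V; V \<subseteq> U; s \<in> sec F U\<rbrakk> \<Longrightarrow>
        restr F V W (restr F U V s) = restr F U W s"
    and gluing:
      "\<lbrakk>\<And>V. V \<in> \<U> \<Longrightarrow> zariski_open n V; \<And>V. V \<in> \<U> \<Longrightarrow> \<sigma> V \<in> sec F V;
        \<And>V W. \<lbrakk>V \<in> \<U>; W \<in> \<U>\<rbrakk> \<Longrightarrow> restr F V (V \<inter> W) (\<sigma> V) = restr F W (V \<inter> W) (\<sigma> W)\<rbrakk> \<Longrightarrow>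
        \<exists>!t. t \<in> sec F (\<Union>\<U>) \<and> (\<forall>V\<in>\<U>. restr F (\<Union>\<U>) V t = \<sigma> V)"

text \<open>
  Coherence over the (locally Noetherian) space \<open>P\<^sup>n\<close>: every point has an open neighbourhood \<open>U\<close>
  with an exact sequence \<open>\<O>\<^sub>U\<^sup>a \<rightarrow> \<O>\<^sub>U\<^sup>b \<rightarrow> F|\<^sub>U \<rightarrow> 0\<close>. The second map is given by
  sections \<open>s 0, \<dots>, s (b-1)\<close> of \<open>F\<close> over \<open>U\<close>, the first by relations
  \<open>\<rho> 0, \<dots>, \<rho> (a-1)\<close> among them; the conjuncts of \<open>locally_presented\<close> say that the composite
  vanishes, that the second map is surjective (on germs), and that the image of the
  first map is the whole kernel (on germs).
\<close>

definition locally_presented ::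
  "nat \<Rightarrow> 's mod_sheaf \<Rightarrow> point set \<Rightarrow> nat \<Rightarrow> (nat \<Rightarrow> 's) \<Rightarrow> nat \<Rightarrow> (nat \<Rightarrow> nat \<Rightarrow> vec \<Rightarrow> complex) \<Rightarrow> bool"
  where
  "locally_presented n F U b s a \<rho> \<longleftrightarrow>
     (\<forall>k<b. s k \<in> sec F U) \<and>
     (\<forall>l<a. \<forall>k<b. \<rho> l k \<in> carrier (structure_ring n U)) \<and>
     (\<forall>l<a. (\<Oplus>\<^bsub>sections F U\<^esub>k\<in>{..<b}. \<rho> l k \<odot>\<^bsub>sections F U\<^esub> s k) = \<zero>\<^bsub>sections F U\<^esub>) \<and>
     (\<forall>V t P. zariski_open n V \<and> V \<subseteq> U \<and> t \<in> sec F V \<and> P \<in> V \<longrightarrow>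
        (\<exists>W f. zariski_open n W \<and> P \<in> W \<and> W \<subseteq> V \<and>
           (\<forall>k<b. f k \<in> carrier (structure_ring n W)) \<and>
           restr F V W t = (\<Oplus>\<^bsub>sections F W\<^esub>k\<in>{..<b}. f k \<odot>\<^bsub>sections F W\<^esub> restr F U W (s k)))) \<and>
     (\<forall>V f P. zariski_open n V \<and> V \<subseteq> U \<and> P \<in> V \<and>
        (\<forall>k<b. f k \<in> carrier (structure_ring n V)) \<and>
        (\<Oplus>\<^bsub>sections F V\<^esub>k\<in>{..<b}. f k \<odot>\<^bsub>sections F V\<^esub> restr F U V (s k)) = \<zero>\<^bsub>sections F V\<^esub> \<longrightarrow>
        (\<exists>W g. zariski_open n W \<and> P \<in> W \<and> W \<subseteq> V \<and>
           (\<forall>l<a. g l \<in> carrier (structure_ring n W)) \<and>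
           (\<forall>k<b. structure_restr W (f k) =
              (\<Oplus>\<^bsub>structure_ring n W\<^esub>l\<in>{..<a}. g l \<otimes>\<^bsub>structure_ring n W\<^esub> structure_restr W (\<rho> l k)))))"

definition coherent :: "nat \<Rightarrow> 's mod_sheaf \<Rightarrow> bool" where
  "coherent n F \<longleftrightarrow> sheaf_of_modules n F \<and>
     (\<forall>P\<in>proj_space n. \<exists>U b s a \<rho>. zariski_open n U \<and> P \<in> U \<and> locally_presented n F U b s a \<rho>)"

text \<open>Morphisms of \<open>\<O>\<close>-modules, extensional in both arguments.\<close>

definition sheaf_hom :: "nat \<Rightarrow> 's mod_sheaf \<Rightarrow> 't mod_sheaf \<Rightarrow> (point set \<Rightarrow> 's \<Rightarrow> 't) set" where
  "sheaf_hom n F G =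
     {\<phi> \<in> extensional (Collect (zariski_open n)).
        (\<forall>U. zariski_open n U \<longrightarrow>
           \<phi> U \<in> extensional (sec F U) \<and>
           \<phi> U \<in> LinearCombinations.module_hom (structure_ring n U) (sections F U) (sections G U)) \<and>
        (\<forall>U V. zariski_open n U \<and> zariski_open n V \<and> V \<subseteq> U \<longrightarrow>
           (\<forall>s\<in>sec F U. restr G U V (\<phi> U s) = \<phi> V (restr F U V s)))}"


section \<open>Global sections and strong Kronecker stability\<close>

definition complex_field :: "complex ring" where
  "complex_field = \<lparr>carrier = UNIV, mult = (*), one = 1, zero = 0, add = (+)\<rparr>"

text \<open>\<open>H\<^sup>0(F)\<close> as a complex vector space: scalars act through constant functions.\<close>

definition H0 :: "nat \<Rightarrow> 's mod_sheaf \<Rightarrow> (complex, 's) module" where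
  "H0 n F =
     \<lparr>carrier = sec F (proj_space n),
      mult = undefined,
      one = undefined,
      zero = \<zero>\<^bsub>sections F (proj_space n)\<^esub>,
      add = (\<oplus>\<^bsub>sections F (proj_space n)\<^esub>),
      smult = (\<lambda>c s. (\<lambda>x\<in>\<Union>(proj_space n). c) \<odot>\<^bsub>sections F (proj_space n)\<^esub> s)\<rparr>"

definition dim_in_H0 :: "nat \<Rightarrow> 's mod_sheaf \<Rightarrow> 's set \<Rightarrow> nat" where
  "dim_in_H0 n F V = vectorspace.dim complex_field ((H0 n F)\<lparr>carrier := V\<rparr>)"

definition h0 :: "nat \<Rightarrow> 's mod_sheaf \<Rightarrow> nat" where
  "h0 n F = vectorspace.dim complex_field (H0 n F)"

text \<open>
  An element \<open>\<Sum> v\<^sub>k \<otimes> \<phi>\<^sub>k\<close> of the tensor product \<open>V \<otimes> Hom(E1, E2)\<close> is represented by the list of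
  its summands \<open>(v\<^sub>k, \<phi>\<^sub>k)\<close> (scalars may be absorbed in \<open>v\<^sub>k\<close>); \<open>ev\<close> sends it to \<open>\<Sum> \<phi>\<^sub>k(v\<^sub>k)\<close>.
  This does not depend on the representative, and only the image of \<open>ev\<close> on \<open>V \<otimes> Hom(E1, E2)\<close> is
  used below.
\<close>

definition tensors :: "'s set \<Rightarrow> (point set \<Rightarrow> 's \<Rightarrow> 't) set \<Rightarrow> ('s \<times> (point set \<Rightarrow> 's \<Rightarrow> 't)) list set"
  where "tensors V \<Phi> = lists (V \<times> \<Phi>)"

definition ev :: "nat \<Rightarrow> 't mod_sheaf \<Rightarrow> ('s \<times> (point set \<Rightarrow> 's \<Rightarrow> 't)) list \<Rightarrow> 't" where
  "ev n E2 ts = foldr (\<lambda>(v, \<phi>) w. \<phi> (proj_space n) v \<oplus>\<^bsub>H0 n E2\<^esub> w) ts \<zero>\<^bsub>H0 n E2\<^esub>"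

definition strongly_Kronecker_stable :: "nat \<Rightarrow> 's mod_sheaf \<Rightarrow> 't mod_sheaf \<Rightarrow> bool" where
  "strongly_Kronecker_stable n E1 E2 \<longleftrightarrow>
     coherent n E1 \<and> coherent n E2 \<and>
     carrier (H0 n E2) \<noteq> {\<zero>\<^bsub>H0 n E2\<^esub>} \<and>
     ev n E2 ` tensors (carrier (H0 n E1)) (sheaf_hom n E1 E2) = carrier (H0 n E2) \<and>
     (\<forall>V. VectorSpace.subspace complex_field V (H0 n E1) \<and>
          V \<noteq> {\<zero>\<^bsub>H0 n E1\<^esub>} \<and> V \<noteq> carrier (H0 n E1) \<longrightarrow>
        real (dim_in_H0 n E2 (ev n E2 ` tensors V (sheaf_hom n E1 E2))) / real (h0 n E2)
          > real (dim_in_H0 n E1 V) / real (h0 n E1))"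

end

theory Submission
  imports Defs "HOL-Computational_Algebra.Fundamental_Theorem_Algebra"
    "HOL-Computational_Algebra.Polynomial_Factorial" "HOL-Computational_Algebra.Field_as_Ring"
begin

text \<open>
  Global sections of \<open>\<O>(d)\<close> are the forms of degree \<open>d\<close>, so the image of \<open>ev\<close> on \<open>V \<otimes> Hom\<close>
  contains all products of elements of \<open>V\<close> with forms of degree \<open>j\<close>. The dimension of a space of forms
  is the number of its leading monomials for the lexicographic order, and multiplying by a monomial
  shifts leading monomials. This reduces the inequality to a statement about a proper nonempty set \<open>M\<close>
  of monomials of degree \<open>i\<close>: the multiples of degree \<open>i + j\<close> occupy a larger proportion of all
  monomials of that degree than \<open>M\<close> does in degree \<open>i\<close>. For \<open>j = 1\<close> this is a weighted double count,
  strict because some move replacing one variable by another leaves \<open>M\<close>; the general case iterates.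

  That a global section is a form is seen on lines: restricted to a line missing the origin it is a
  rational function without poles, hence a polynomial, of degree at most \<open>d\<close> by homogeneity. Lagrange
  interpolation in each coordinate then gives a polynomial in all coordinates.
\<close>

section \<open>Polynomials and their evaluation\<close>

text \<open>The constants of the double count are the growth rate of the full levels: passing from
  degree \<open>d\<close> to \<open>d + 1\<close> multiplies the number of monomials in
  \<open>n + 1\<close> variables by \<open>(d + n + 1) / (d + 1)\<close>. Counting multiples without
  weights gives a weaker rate as soon as \<open>d > 0\<close>; weighting by exponents makes the
  bound exact for the full level. Since equality does occur there, strictness has to come from
  properness of \<open>M\<close>. Only one inclusion is available for the image of
  \<open>ev\<close>: its leading monomials contain the multiples of those of \<open>V\<close>. It
  points in the right direction, so Hom need not be determined; multiplications by monomials
  suffice. Surjectivity comes from the same inclusion, because the multiples of the full level fill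
  the higher level. The dimension count applies to linear subspaces only, so the image of
  \<open>ev\<close>, a set of values on lists, has to be recognized as one. For global sections the
  obstacle is the origin, where a section has no value: every line and every interpolation node must
  avoid it.\<close>

definition mono_eval :: "(nat \<Rightarrow>\<^sub>0 nat) \<Rightarrow> vec \<Rightarrow> complex" where
  "mono_eval m x = (\<Prod>k\<in>Poly_Mapping.keys m. x k ^ Poly_Mapping.lookup m k)"

definition mono_degree :: "(nat \<Rightarrow>\<^sub>0 nat) \<Rightarrow> nat" where
  "mono_degree m = (\<Sum>k\<in>Poly_Mapping.keys m. Poly_Mapping.lookup m k)"

definition monomials :: "nat \<Rightarrow> nat \<Rightarrow> (nat \<Rightarrow>\<^sub>0 nat) set" where
  "monomials n d = {m. Poly_Mapping.keys m \<subseteq> {..n} \<and> mono_degree m = d}"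

lemma mono_eval_superset:
  assumes "finite A" "Poly_Mapping.keys m \<subseteq> A"
  shows "mono_eval m x = (\<Prod>k\<in>A. x k ^ Poly_Mapping.lookup m k)"
  unfolding mono_eval_def
  by (rule prod.mono_neutral_left) (use assms in \<open>auto simp: in_keys_iff\<close>)

lemma mono_degree_superset:
  assumes "finite A" "Poly_Mapping.keys m \<subseteq> A"
  shows "mono_degree m = (\<Sum>k\<in>A. Poly_Mapping.lookup m k)"
  unfolding mono_degree_def
  by (rule sum.mono_neutral_left) (use assms in \<open>auto simp: in_keys_iff\<close>)

text \<open>Natural exponents cannot cancel, so the general inclusion \<open>keys_add\<close>
  becomes an equality.\<close>

lemma keys_add_nat:
  "Poly_Mapping.keys (a + b :: nat \<Rightarrow>\<^sub>0 nat) = Poly_Mapping.keys a \<union> Poly_Mapping.keys b"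
  by (auto simp: in_keys_iff lookup_add)

lemma mono_eval_add: "mono_eval (a + b) x = mono_eval a x * mono_eval b x"
proof -
  let ?A = "Poly_Mapping.keys a \<union> Poly_Mapping.keys b"
  show ?thesis
    by (subst (1 2 3) mono_eval_superset[of ?A])
      (auto simp: keys_add_nat lookup_add power_add prod.distrib)
qed

lemma mono_degree_add: "mono_degree (a + b) = mono_degree a + mono_degree b"
proof -
  let ?A = "Poly_Mapping.keys a \<union> Poly_Mapping.keys b"
  show ?thesis
    by (subst (1 2 3) mono_degree_superset[of ?A])
      (auto simp: keys_add_nat lookup_add sum.distrib)
qed

lemma mono_degree_single [simp]: "mono_degree (Poly_Mapping.single k c) = c"
  by (auto simp: mono_degree_def)

lemma mono_eval_0 [simp]: "mono_eval 0 x = 1"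
  by (simp add: mono_eval_def)

lemma mono_eval_single [simp]: "mono_eval (Poly_Mapping.single k c) x = x k ^ c"
  by (auto simp: mono_eval_def)

lemma mono_eval_scale: "mono_eval m (\<lambda>k. c * x k) = c ^ mono_degree m * mono_eval m x"
  by (simp add: mono_eval_def mono_degree_def power_mult_distrib prod.distrib power_sum)

lemma monomials_add:
  "a \<in> monomials n d \<Longrightarrow> b \<in> monomials n e \<Longrightarrow> a + b \<in> monomials n (d + e)"
  by (auto simp: monomials_def keys_add_nat mono_degree_add)

lemma single_in_monomials: "k \<le> n \<Longrightarrow> Poly_Mapping.single k d \<in> monomials n d"
  by (auto simp: monomials_def)

lemma homogeneous_iff: "homogeneous n e p \<longleftrightarrow> Poly_Mapping.keys p \<subseteq> monomials n e"
  by (auto simp: homogeneous_def monomials_def mono_degree_def)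

lemma mpoly_eval_eq: "mpoly_eval p x = (\<Sum>m\<in>Poly_Mapping.keys p. Poly_Mapping.lookup p m * mono_eval m x)"
  by (simp add: mpoly_eval_def mono_eval_def)

lemma mpoly_eval_0 [simp]: "mpoly_eval 0 x = 0"
  by (simp add: mpoly_eval_eq)

lemma mpoly_eval_single [simp]: "mpoly_eval (Poly_Mapping.single m c) x = c * mono_eval m x"
  by (auto simp: mpoly_eval_eq)

lemma mpoly_eval_add: "mpoly_eval (p + q) x = mpoly_eval p x + mpoly_eval q x"
  unfolding mpoly_eval_eq by (rule setsum_keys_plus_distrib) (auto simp: algebra_simps)

lemma mpoly_eval_sum: "mpoly_eval (\<Sum>i\<in>I. p i) x = (\<Sum>i\<in>I. mpoly_eval (p i) x)"
  by (induction I rule: infinite_finite_induct) (auto simp: mpoly_eval_add)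

lemma mpoly_sum_singles:
  "p = (\<Sum>m\<in>Poly_Mapping.keys p. Poly_Mapping.single m (Poly_Mapping.lookup p m))"
  by (rule poly_mapping_eqI)
    (auto simp: lookup_sum lookup_single when_def sum.delta' in_keys_iff cong: if_cong)

lemma mpoly_eval_mult: "mpoly_eval (p * q) x = mpoly_eval p x * mpoly_eval q x"
proof -
  have "p * q = (\<Sum>a\<in>Poly_Mapping.keys p. \<Sum>b\<in>Poly_Mapping.keys q.
      Poly_Mapping.single (a + b) (Poly_Mapping.lookup p a * Poly_Mapping.lookup q b))"
    by (subst mpoly_sum_singles[of p], subst mpoly_sum_singles[of q])
      (simp add: sum_product mult_single)
  then show ?thesis
    by (simp add: mpoly_eval_sum mono_eval_add)
      (simp add: mpoly_eval_eq sum_product algebra_simps)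
qed

lemma mpoly_eval_1 [simp]: "mpoly_eval 1 x = 1"
  by (simp flip: single_one)

lemma mpoly_eval_minus: "mpoly_eval (p - q) x = mpoly_eval p x - mpoly_eval q x"
  using mpoly_eval_add[of "p - q" q x] by (simp add: algebra_simps)

lemma homogeneous_0 [simp]: "homogeneous n e 0"
  by (simp add: homogeneous_iff)

lemma homogeneous_single: "m \<in> monomials n e \<Longrightarrow> homogeneous n e (Poly_Mapping.single m c)"
  by (auto simp: homogeneous_iff)

lemma homogeneous_const [simp]: "homogeneous n 0 (Poly_Mapping.single 0 c)"
  by (rule homogeneous_single) (auto simp: monomials_def mono_degree_def)

lemma homogeneous_1 [simp]: "homogeneous n 0 1"
  using homogeneous_const[of n 1] by simp

lemma homogeneous_add: "homogeneous n e p \<Longrightarrow> homogeneous n e q \<Longrightarrow> homogeneous n e (p + q)"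
  using keys_add[of p q] by (auto simp: homogeneous_iff)

lemma homogeneous_minus: "homogeneous n e p \<Longrightarrow> homogeneous n e q \<Longrightarrow> homogeneous n e (p - q)"
  using keys_diff[of p q] by (auto simp: homogeneous_iff)

lemma homogeneous_sum: "(\<And>i. i \<in> I \<Longrightarrow> homogeneous n e (p i)) \<Longrightarrow> homogeneous n e (\<Sum>i\<in>I. p i)"
  by (induction I rule: infinite_finite_induct) (auto intro: homogeneous_add)

lemma homogeneous_mult:
  "homogeneous n d p \<Longrightarrow> homogeneous n e q \<Longrightarrow> homogeneous n (d + e) (p * q)"
  using keys_mult[of p q] unfolding homogeneous_iff by (blast intro: monomials_add)

lemma homogeneous_const_mult:
  "homogeneous n e p \<Longrightarrow> homogeneous n e (Poly_Mapping.single 0 c * p)"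
  using homogeneous_mult[OF homogeneous_const, of n e p c] by simp

lemma mpoly_eval_scale:
  assumes "homogeneous n e p"
  shows "mpoly_eval p (\<lambda>k. c * x k) = c ^ e * mpoly_eval p x"
  unfolding mpoly_eval_eq sum_distrib_left
  by (rule sum.cong) (use assms in \<open>auto simp: homogeneous_iff monomials_def mono_eval_scale\<close>)

lemma mono_eval_on_line: "\<exists>P. \<forall>t. poly P t = mono_eval m (\<lambda>k. x k + t * y k)"
  by (rule exI[of _ "\<Prod>k\<in>Poly_Mapping.keys m. [:x k, y k:] ^ Poly_Mapping.lookup m k"])
    (simp add: mono_eval_def poly_prod)

text \<open>Restriction to a parametrized line reduces questions about sections to polynomials in
  one variable, where gcds and roots are available.\<close>

lemma mpoly_eval_on_line: "\<exists>P. \<forall>t. poly P t = mpoly_eval p (\<lambda>k. x k + t * y k)"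
proof -
  have "\<forall>m. \<exists>P. \<forall>t. poly P t = mono_eval m (\<lambda>k. x k + t * y k)"
    using mono_eval_on_line by blast
  then obtain M where M: "\<And>m t. poly (M m) t = mono_eval m (\<lambda>k. x k + t * y k)"
    unfolding choice_iff by blast
  show ?thesis
    by (rule exI[of _ "\<Sum>m\<in>Poly_Mapping.keys p. smult (Poly_Mapping.lookup p m) (M m)"])
      (simp add: mpoly_eval_eq poly_sum M)
qed

text \<open>Uniqueness of base \<open>N\<close> expansions: the lowest digit is the remainder modulo
  \<open>N\<close>, the others follow by induction. It decodes exponents in the substitution
  below.\<close>

lemma digits_inj:
  fixes f g :: "nat \<Rightarrow> nat"
  assumes "\<And>k. k \<le> n \<Longrightarrow> f k < N" "\<And>k. k \<le> n \<Longrightarrow> g k < N"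
    and "(\<Sum>k\<le>n. f k * N ^ k) = (\<Sum>k\<le>n. g k * N ^ k)" and "k \<le> n"
  shows "f k = g k"
  using assms
proof (induction n arbitrary: f g k)
  case (Suc n)
  have split: "(\<Sum>k\<le>Suc n. h k * N ^ k) = h 0 + N * (\<Sum>k\<le>n. h (Suc k) * N ^ k)" for h :: "nat \<Rightarrow> nat"
    by (subst sum.atMost_Suc_shift) (simp add: sum_distrib_left algebra_simps)
  have lt: "f 0 < N" "g 0 < N" using Suc.prems by auto
  have eq: "f 0 + N * (\<Sum>k\<le>n. f (Suc k) * N ^ k) = g 0 + N * (\<Sum>k\<le>n. g (Suc k) * N ^ k)"
    using Suc.prems(3) unfolding split .
  have 0: "f 0 = g 0"
    using arg_cong[OF eq, of "\<lambda>z. z mod N"] lt by simp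
  have "(\<Sum>k\<le>n. f (Suc k) * N ^ k) = (\<Sum>k\<le>n. g (Suc k) * N ^ k)"
    using eq 0 lt by simp
  then have S: "f (Suc k) = g (Suc k)" if "k \<le> n" for k
    using Suc.IH[of "\<lambda>k. f (Suc k)" "\<lambda>k. g (Suc k)" k] Suc.prems(1,2) that by auto
  show ?case
    using 0 S Suc.prems(4) by (cases k) auto
qed auto

text \<open>Kronecker substitution: on the curve with coordinates \<open>t ^ (N ^ k)\<close> distinct monomials with
  exponents below \<open>N\<close> become distinct powers of \<open>t\<close>.\<close>

lemma mpoly_eval_nonzero:
  assumes "p \<noteq> 0" and vars: "\<And>m. m \<in> Poly_Mapping.keys p \<Longrightarrow> Poly_Mapping.keys m \<subseteq> {..n}"
  shows "\<exists>x\<in>punctured_space n. mpoly_eval p x \<noteq> 0"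
proof -
  \<comment> \<open>A crude base: it exceeds the sum of all degrees, hence every exponent occurring
    in \<open>p\<close>.\<close>
  define N where "N = Suc (\<Sum>m\<in>Poly_Mapping.keys p. mono_degree m)"
  define code where "code m = (\<Sum>k\<le>n. Poly_Mapping.lookup m k * N ^ k)" for m :: "nat \<Rightarrow>\<^sub>0 nat"
  define Q where "Q = (\<Sum>m\<in>Poly_Mapping.keys p. monom (Poly_Mapping.lookup p m) (code m))"
  have bound: "Poly_Mapping.lookup m k < N" if "m \<in> Poly_Mapping.keys p" for m k
  proof -
    have "Poly_Mapping.lookup m k \<le> mono_degree m"
      unfolding mono_degree_def
      by (cases "k \<in> Poly_Mapping.keys m") (auto intro!: member_le_sum simp: in_keys_iff)
    also have "\<dots> \<le> (\<Sum>m\<in>Poly_Mapping.keys p. mono_degree m)"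
      by (rule member_le_sum) (use that in auto)
    finally show ?thesis unfolding N_def by simp
  qed
  have inj: "m = m'" if "m \<in> Poly_Mapping.keys p" "m' \<in> Poly_Mapping.keys p" "code m = code m'" for m m'
  proof (rule poly_mapping_eqI)
    fix k
    show "Poly_Mapping.lookup m k = Poly_Mapping.lookup m' k"
    proof (cases "k \<le> n")
      case True
      then show ?thesis
        using digits_inj[of n "Poly_Mapping.lookup m" N "Poly_Mapping.lookup m'" k] that bound
        unfolding code_def by auto
    next
      case False
      then show ?thesis using vars[OF that(1)] vars[OF that(2)]
        by (metis atMost_iff in_keys_iff subsetD)
    qed
  qed
  obtain m0 where m0: "m0 \<in> Poly_Mapping.keys p" using \<open>p \<noteq> 0\<close> by fastforce
  have "coeff Q (code m0) = (\<Sum>m\<in>Poly_Mapping.keys p. if m = m0 then Poly_Mapping.lookup p m else 0)"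
    unfolding Q_def coeff_sum by (rule sum.cong) (use inj m0 in auto)
  also have "\<dots> \<noteq> 0" using m0 by (simp add: sum.delta in_keys_iff)
  \<comment> \<open>The extra factor forces the non-root \<open>t\<close> to be nonzero, so that the
    point on the curve is not the origin.\<close>
  finally have "Q * [:0, 1:] \<noteq> 0" by auto
  then obtain t where t: "poly (Q * [:0, 1:]) t \<noteq> 0" by (metis poly_all_0_iff_0)
  then have t0: "t \<noteq> 0" and Qt: "poly Q t \<noteq> 0" by auto
  define x where "x k = (if k \<le> n then t ^ (N ^ k) else 0)" for k
  have "mono_eval m x = t ^ code m" if "m \<in> Poly_Mapping.keys p" for m
  proof -
    have "mono_eval m x = (\<Prod>k\<le>n. x k ^ Poly_Mapping.lookup m k)"
      by (rule mono_eval_superset) (use vars[OF that] in auto)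
    also have "\<dots> = (\<Prod>k\<le>n. t ^ (Poly_Mapping.lookup m k * N ^ k))"
      by (rule prod.cong) (auto simp: x_def mult.commute simp flip: power_mult)
    finally show ?thesis by (simp add: code_def power_sum)
  qed
  then have "mpoly_eval p x = poly Q t"
    by (simp add: mpoly_eval_eq Q_def poly_sum poly_monom)
  moreover have "x \<in> punctured_space n"
    unfolding punctured_space_def x_def using t0 by (auto intro!: exI[of _ 0])
  ultimately show ?thesis using Qt by (intro bexI[of _ x]) simp_all
qed

lemma homogeneous_eqI:
  assumes "homogeneous n d p" "homogeneous n d q"
    and "\<And>x. x \<in> punctured_space n \<Longrightarrow> mpoly_eval p x = mpoly_eval q x"
  shows "p = q"
proof (rule ccontr)
  assume "p \<noteq> q"
  moreover have "homogeneous n d (p - q)" using assms by (intro homogeneous_minus)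
  ultimately obtain x where "x \<in> punctured_space n" "mpoly_eval (p - q) x \<noteq> 0"
    using mpoly_eval_nonzero[of "p - q" n] by (auto simp: homogeneous_iff monomials_def)
  then show False using assms(3) by (simp add: mpoly_eval_minus)
qed

text \<open>Compare the coefficients of \<open>s ^ d\<close> in \<open>p (s x) = s ^ d p (x)\<close>.\<close>

lemma homogeneous_part_eval:
  assumes vars: "\<And>m. m \<in> Poly_Mapping.keys p \<Longrightarrow> Poly_Mapping.keys m \<subseteq> {..n}"
  obtains q where "homogeneous n d q"
    and "\<And>x. (\<And>s. s \<noteq> 0 \<Longrightarrow> mpoly_eval p (\<lambda>k. s * x k) = s ^ d * mpoly_eval p x) \<Longrightarrow>
      mpoly_eval q x = mpoly_eval p x"
proof
  let ?K = "{m \<in> Poly_Mapping.keys p. mono_degree m = d}"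
  let ?q = "\<Sum>m\<in>?K. Poly_Mapping.single m (Poly_Mapping.lookup p m)"
  show "homogeneous n d ?q"
    by (intro homogeneous_sum homogeneous_single) (use vars in \<open>auto simp: monomials_def\<close>)
  fix x
  assume hom: "\<And>s. s \<noteq> 0 \<Longrightarrow> mpoly_eval p (\<lambda>k. s * x k) = s ^ d * mpoly_eval p x"
  let ?Q = "\<Sum>m\<in>Poly_Mapping.keys p. monom (Poly_Mapping.lookup p m * mono_eval m x) (mono_degree m)"
  \<comment> \<open>The scaling hypothesis excludes \<open>s = 0\<close>. The factor
    \<open>[:0, 1:]\<close> makes both sides vanish there and is cancelled afterwards.\<close>
  have "poly (?Q * [:0, 1:]) s = poly (monom (mpoly_eval p x) d * [:0, 1:]) s" for s
  proof (cases "s = 0")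
    case False
    then show ?thesis using hom[OF False]
      by (simp add: mpoly_eval_eq poly_sum poly_monom mono_eval_scale algebra_simps)
  qed auto
  then have "?Q * [:0, 1:] = monom (mpoly_eval p x) d * [:0, 1:]"
    by (intro poly_ext)
  then have "?Q = monom (mpoly_eval p x) d" by simp
  then have "mpoly_eval p x = coeff ?Q d" by simp
  also have "\<dots> = (\<Sum>m\<in>Poly_Mapping.keys p.
      if mono_degree m = d then Poly_Mapping.lookup p m * mono_eval m x else 0)"
    by (simp add: coeff_sum)
  also have "\<dots> = mpoly_eval ?q x"
    by (simp add: mpoly_eval_sum sum.If_cases Int_def)
  finally show "mpoly_eval ?q x = mpoly_eval p x" by simp
qed

section \<open>Points, open sets and local representations\<close>

lemma punctured_space_scale: "x \<in> punctured_space n \<Longrightarrow> c \<noteq> 0 \<Longrightarrow> (\<lambda>k. c * x k) \<in> punctured_space n"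
  by (auto simp: punctured_space_def)

lemma mem_point_of: "x \<in> point_of x"
  unfolding point_of_def by (rule CollectI, rule exI[of _ 1]) simp

lemma point_of_scale: "c \<noteq> 0 \<Longrightarrow> point_of (\<lambda>k. c * x k) = point_of x"
proof (intro Set.set_eqI iffI)
  fix y assume c: "c \<noteq> 0" and "y \<in> point_of (\<lambda>k. c * x k)"
  then obtain a where "a \<noteq> 0" "y = (\<lambda>k. a * (c * x k))" by (auto simp: point_of_def)
  then show "y \<in> point_of x" using c
    by (auto simp: point_of_def intro!: exI[of _ "a * c"])
next
  fix y assume c: "c \<noteq> 0" and "y \<in> point_of x"
  then obtain a where "a \<noteq> 0" "y = (\<lambda>k. a * x k)" by (auto simp: point_of_def)
  then show "y \<in> point_of (\<lambda>k. c * x k)" using c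
    by (auto simp: point_of_def intro!: exI[of _ "a / c"])
qed

lemma proj_spaceE:
  assumes "P \<in> proj_space n"
  obtains x where "x \<in> punctured_space n" "P = point_of x"
  using assms by (auto simp: proj_space_def)

lemma mem_proj_point:
  assumes "P \<in> proj_space n" "x \<in> P"
  shows "x \<in> punctured_space n \<and> P = point_of x"
proof -
  obtain y where y: "y \<in> punctured_space n" "P = point_of y" using assms(1) by (rule proj_spaceE)
  then obtain c where "c \<noteq> 0" "x = (\<lambda>k. c * y k)" using assms(2) by (auto simp: point_of_def)
  then show ?thesis using y by (simp add: point_of_scale punctured_space_scale)
qed

lemma Union_proj_space: "\<Union>(proj_space n) = punctured_space n"
proof (intro Set.set_eqI iffI)
  fix x assume "x \<in> punctured_space n"
  then show "x \<in> \<Union>(proj_space n)" using mem_point_of[of x] by (auto simp: proj_space_def)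
qed (use mem_proj_point in blast)

lemma zariski_open_subset: "zariski_open n U \<Longrightarrow> U \<subseteq> proj_space n"
  by (auto simp: zariski_open_def)

text \<open>A vector lies on only one line through the origin, so the cone over \<open>U\<close>
  remembers \<open>U\<close>.\<close>

lemma mem_Union_iff:
  assumes "U \<subseteq> proj_space n"
  shows "x \<in> \<Union>U \<longleftrightarrow> x \<in> punctured_space n \<and> point_of x \<in> U"
  using assms mem_proj_point mem_point_of by blast

section \<open>Principal open sets as a basis of the topology\<close>

definition basic_open :: "nat \<Rightarrow> mpoly \<Rightarrow> point set" where
  "basic_open n s = point_of ` {x \<in> punctured_space n. mpoly_eval s x \<noteq> 0}"

text \<open>A form scales by a power of the nonzero factor, so its vanishing does not depend on the
  representative of the point.\<close>

lemma point_of_in_basic_open: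
  assumes "homogeneous n e s" "x \<in> punctured_space n"
  shows "point_of x \<in> basic_open n s \<longleftrightarrow> mpoly_eval s x \<noteq> 0"
proof
  assume "point_of x \<in> basic_open n s"
  then obtain y where y: "mpoly_eval s y \<noteq> 0" "point_of x = point_of y"
    by (auto simp: basic_open_def)
  then obtain c where "c \<noteq> 0" "x = (\<lambda>k. c * y k)"
    using mem_point_of[of x] by (auto simp: point_of_def)
  then show "mpoly_eval s x \<noteq> 0" using y assms by (simp add: mpoly_eval_scale)
qed (use assms in \<open>auto simp: basic_open_def\<close>)

lemma basic_open_subset: "basic_open n s \<subseteq> proj_space n"
  by (auto simp: basic_open_def proj_space_def)

lemma mem_Union_basic_open:
  assumes "homogeneous n e s"
  shows "x \<in> \<Union>(basic_open n s) \<longleftrightarrow> x \<in> punctured_space n \<and> mpoly_eval s x \<noteq> 0"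
  using mem_Union_iff[OF basic_open_subset] point_of_in_basic_open[OF assms] by blast

lemma zariski_open_basic_open:
  assumes "homogeneous n e s"
  shows "zariski_open n (basic_open n s)"
proof -
  have "P \<in> basic_open n s \<longleftrightarrow> P \<in> proj_space n \<and> \<not> (\<forall>x\<in>P. mpoly_eval s x = 0)" for P
    using mem_Union_basic_open[OF assms] basic_open_subset[of n s] mem_proj_point[of P n]
      point_of_in_basic_open[OF assms]
    by (metis mem_point_of proj_spaceE subsetD)
  then show ?thesis
    unfolding zariski_open_def using assms by (intro exI[of _ "{s}"]) auto
qed

lemma zariski_open_proj_space: "zariski_open n (proj_space n)"
proof -
  have "proj_space n = basic_open n 1"
    by (auto simp: basic_open_def proj_space_def)
  then show ?thesis using zariski_open_basic_open[OF homogeneous_1, of n] by simp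
qed

text \<open>A point belongs to \<open>U\<close> because some form of the defining family is nonzero
  there, and that form alone cuts out a neighbourhood inside \<open>U\<close>. A neighbourhood given
  by one form can later be restricted to a line.\<close>

lemma zariski_open_basic:
  assumes "zariski_open n U" "P \<in> U"
  obtains s e where "homogeneous n e s" "P \<in> basic_open n s" "basic_open n s \<subseteq> U"
proof -
  obtain S where S: "\<And>p. p \<in> S \<Longrightarrow> \<exists>e. homogeneous n e p"
    and U: "U = proj_space n - {P \<in> proj_space n. \<forall>p\<in>S. \<forall>x\<in>P. mpoly_eval p x = 0}"
    using assms(1) unfolding zariski_open_def by blast
  obtain s x where s: "s \<in> S" "x \<in> P" "mpoly_eval s x \<noteq> 0" using assms(2) U by auto
  obtain e where e: "homogeneous n e s" using S s(1) by blast
  have P: "x \<in> punctured_space n" "P = point_of x"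
    using mem_proj_point[of P n x] assms(2) U s(2) by auto
  have "basic_open n s \<subseteq> U"
    using s(1) basic_open_subset[of n s] mem_point_of
    unfolding U by (fastforce simp: basic_open_def)
  then show ?thesis
    using that[of e s] e P s by (simp add: point_of_in_basic_open)
qed

lemma zariski_open_Int:
  assumes "zariski_open n U" "zariski_open n V"
  shows "zariski_open n (U \<inter> V)"
proof -
  \<comment> \<open>The largest possible family: all forms whose principal open set lies in the
    intersection. They cover it because a product \<open>s * t\<close> is nonzero exactly where both
    factors are.\<close>
  define S where "S = {s. (\<exists>e. homogeneous n e s) \<and> basic_open n s \<subseteq> U \<inter> V}"
  have "P \<in> U \<inter> V \<longleftrightarrow> P \<in> proj_space n \<and> (\<exists>s\<in>S. \<exists>x\<in>P. mpoly_eval s x \<noteq> 0)" for P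
  proof
    assume P: "P \<in> U \<inter> V"
    obtain s e where s: "homogeneous n e s" "P \<in> basic_open n s" "basic_open n s \<subseteq> U"
      using zariski_open_basic[OF assms(1)] P by blast
    obtain t d where t: "homogeneous n d t" "P \<in> basic_open n t" "basic_open n t \<subseteq> V"
      using zariski_open_basic[OF assms(2)] P by blast
    obtain x where x: "x \<in> punctured_space n" "P = point_of x"
      using P zariski_open_subset[OF assms(1)] by (blast elim: proj_spaceE)
    have "basic_open n (s * t) \<subseteq> basic_open n s \<inter> basic_open n t"
      by (auto simp: basic_open_def mpoly_eval_mult)
    then have "s * t \<in> S" using s t homogeneous_mult[OF s(1) t(1)] by (auto simp: S_def)
    moreover have "mpoly_eval (s * t) x \<noteq> 0"
      using s(2) t(2) x point_of_in_basic_open[OF s(1)] point_of_in_basic_open[OF t(1)]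
      by (simp add: mpoly_eval_mult)
    ultimately show "P \<in> proj_space n \<and> (\<exists>s\<in>S. \<exists>x\<in>P. mpoly_eval s x \<noteq> 0)"
      using x mem_point_of by (auto simp: proj_space_def)
  next
    assume P: "P \<in> proj_space n \<and> (\<exists>s\<in>S. \<exists>x\<in>P. mpoly_eval s x \<noteq> 0)"
    then obtain s x where s: "s \<in> S" "x \<in> P" "mpoly_eval s x \<noteq> 0" by blast
    then have "P \<in> basic_open n s"
      using P mem_proj_point by (auto simp: basic_open_def)
    then show "P \<in> U \<inter> V" using s by (auto simp: S_def)
  qed
  then have "U \<inter> V = proj_space n - {P \<in> proj_space n. \<forall>p\<in>S. \<forall>x\<in>P. mpoly_eval p x = 0}"
    by blast
  then show ?thesis
    unfolding zariski_open_def by (intro exI[of _ S] conjI ballI) (simp add: S_def)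
qed

lemma twist_sections_basic:
  assumes "f \<in> twist_sections n d U" "P \<in> U"
  obtains p q s a b e where
    "homogeneous n a p" "homogeneous n b q" "int a - int b = d" "homogeneous n e s"
    "P \<in> basic_open n s" "basic_open n s \<subseteq> U"
    "\<And>x. x \<in> \<Union>(basic_open n s) \<Longrightarrow> mpoly_eval q x \<noteq> 0 \<and> f x = mpoly_eval p x / mpoly_eval q x"
proof -
  obtain V p q a b where V: "zariski_open n V" "P \<in> V" "V \<subseteq> U"
      "homogeneous n a p" "homogeneous n b q" "int a - int b = d"
      "\<forall>x\<in>\<Union>V. mpoly_eval q x \<noteq> 0 \<and> f x = mpoly_eval p x / mpoly_eval q x"
    using assms unfolding twist_sections_def by blast
  obtain s e where "homogeneous n e s" "P \<in> basic_open n s" "basic_open n s \<subseteq> V"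
    using zariski_open_basic[OF V(1,2)] by blast
  then show ?thesis using that[of a p b q e s] V by blast
qed

text \<open>Numerator and denominator of a local fraction scale by powers whose exponents differ by
  \<open>d\<close>; a principal neighbourhood contains the whole line through \<open>x\<close>, so
  one fraction serves both vectors.\<close>

lemma twist_sections_scale:
  assumes f: "f \<in> twist_sections n (int d) U" and U: "U \<subseteq> proj_space n"
    and x: "x \<in> \<Union>U" and c: "c \<noteq> 0"
  shows "f (\<lambda>k. c * x k) = c ^ d * f x"
proof -
  have P: "point_of x \<in> U" "x \<in> punctured_space n" using x mem_Union_iff[OF U] by auto
  obtain p q s a b e where *: "homogeneous n a p" "homogeneous n b q" "int a - int b = int d"
    "homogeneous n e s" "point_of x \<in> basic_open n s"
    "\<And>x. x \<in> \<Union>(basic_open n s) \<Longrightarrow> mpoly_eval q x \<noteq> 0 \<and> f x = mpoly_eval p x / mpoly_eval q x"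
    using twist_sections_basic[OF f P(1)] by metis
  have "x \<in> \<Union>(basic_open n s)" "(\<lambda>k. c * x k) \<in> \<Union>(basic_open n s)"
    using *(5) P c point_of_in_basic_open[OF *(4)]
    unfolding mem_Union_basic_open[OF *(4)]
    by (auto simp: punctured_space_scale mpoly_eval_scale[OF *(4)])
  moreover have "a = b + d" using *(3) by simp
  ultimately show ?thesis
    using *(6) *(1,2) c by (simp add: mpoly_eval_scale power_add)
qed

section \<open>Global sections are homogeneous polynomials\<close>

text \<open>A reduced fraction representing \<open>F\<close> near one point represents it everywhere; at a root of its
  denominator the numerator would have to vanish as well.\<close>

lemma poly_of_local_fractions:
  fixes F :: "complex \<Rightarrow> complex"
  assumes loc: "\<And>t0. \<exists>p q s. poly s t0 \<noteq> 0 \<and>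
      (\<forall>t. poly s t \<noteq> 0 \<longrightarrow> poly q t \<noteq> 0 \<and> F t = poly p t / poly q t)"
  obtains P where "\<And>t. F t = poly P t"
proof -
  obtain p q s where s: "poly s 0 \<noteq> 0"
    and F: "\<And>t. poly s t \<noteq> 0 \<Longrightarrow> poly q t \<noteq> 0 \<and> F t = poly p t / poly q t"
    using loc[of 0] by blast
  define g where "g = gcd p q"
  have "q \<noteq> 0" using F[OF s] by auto
  then have g0: "g \<noteq> 0" by (simp add: g_def)
  obtain p1 q1 where pq: "p = p1 * g" "q = q1 * g" and cop: "coprime p1 q1"
    using gcd_coprime_exists[of p q] g0 unfolding g_def by blast
  \<comment> \<open>Both fractions compute \<open>F\<close> away from the roots of \<open>s\<close>
    and \<open>s'\<close>. Multiplying by \<open>s * s'\<close> makes the identity hold everywhere,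
    and nonzero factors cancel, also at points where \<open>s\<close> vanishes.\<close>
  have cross: "poly p' t * poly q1 t = poly p1 t * poly q' t"
    if s': "poly s' t0 \<noteq> 0"
      "\<And>t. poly s' t \<noteq> 0 \<Longrightarrow> poly q' t \<noteq> 0 \<and> F t = poly p' t / poly q' t" for p' q' s' t t0
  proof -
    have "poly ((p' * q1 - p1 * q') * g * s * s') u = 0" for u
    proof (cases "poly s u = 0 \<or> poly s' u = 0")
      case False
      then show ?thesis using F[of u] s'(2)[of u] unfolding pq by (auto simp: field_simps)
    qed auto
    then have "(p' * q1 - p1 * q') * g * s * s' = 0" using poly_all_0_iff_0 by blast
    then have "p' * q1 = p1 * q'" using g0 s s' by auto
    then show ?thesis by (metis poly_mult)
  qed
  have "poly q1 t0 \<noteq> 0" for t0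
  proof
    assume 0: "poly q1 t0 = 0"
    obtain p' q' s' where s': "poly s' t0 \<noteq> 0"
      "\<And>t. poly s' t \<noteq> 0 \<Longrightarrow> poly q' t \<noteq> 0 \<and> F t = poly p' t / poly q' t"
      using loc[of t0] by blast
    then have "poly p1 t0 = 0" using cross[OF s', of t0] 0 by auto
    then have "[:- t0, 1:] dvd p1" "[:- t0, 1:] dvd q1" using 0 by (simp_all add: poly_eq_0_iff_dvd)
    then have "is_unit [:- t0, 1:]" using cop by (rule coprime_common_divisor[rotated])
    then show False by (simp add: is_unit_pCons_iff)
  qed
  then have "degree q1 = 0"
    using fundamental_theorem_of_algebra constant_degree by metis
  then obtain c where c: "q1 = [:c:]" by (rule degree_eq_zeroE)
  have c0: "c \<noteq> 0" using \<open>\<And>t0. poly q1 t0 \<noteq> 0\<close> c by auto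
  show ?thesis
  proof (rule that[of "smult (1 / c) p1"])
    fix t
    obtain p' q' s' where s': "poly s' t \<noteq> 0"
      "\<And>t. poly s' t \<noteq> 0 \<Longrightarrow> poly q' t \<noteq> 0 \<and> F t = poly p' t / poly q' t"
      using loc[of t] by blast
    then show "F t = poly (smult (1 / c) p1) t"
      using cross[OF s', of t] s'(2)[OF s'(1)] c c0 by (simp add: field_simps)
  qed
qed

text \<open>A local fraction and the form defining its neighbourhood both restrict to polynomials in
  \<open>t\<close>. As the line stays in the punctured space, every parameter is covered by such a
  fraction.\<close>

lemma twist_section_on_line:
  assumes f: "f \<in> twist_sections n d (proj_space n)"
    and line: "\<And>t. (\<lambda>k. x k + t * y k) \<in> punctured_space n"
  obtains P where "\<And>t. f (\<lambda>k. x k + t * y k) = poly P t"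
proof (rule poly_of_local_fractions[where F = "\<lambda>t. f (\<lambda>k. x k + t * y k)"])
  fix t0
  let ?l = "\<lambda>t k. x k + t * y k"
  have "point_of (?l t0) \<in> proj_space n" using line by (simp add: proj_space_def)
  then obtain p q s e where *: "homogeneous n e s" "point_of (?l t0) \<in> basic_open n s"
    "\<And>x. x \<in> \<Union>(basic_open n s) \<Longrightarrow> mpoly_eval q x \<noteq> 0 \<and> f x = mpoly_eval p x / mpoly_eval q x"
    using twist_sections_basic[OF f] by metis
  obtain p1 where p1: "\<And>t. poly p1 t = mpoly_eval p (?l t)"
    using mpoly_eval_on_line[where x=x and y=y and p=p] by blast
  obtain q1 where q1: "\<And>t. poly q1 t = mpoly_eval q (?l t)"
    using mpoly_eval_on_line[where x=x and y=y and p=q] by blast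
  obtain s1 where s1: "\<And>t. poly s1 t = mpoly_eval s (?l t)"
    using mpoly_eval_on_line[where x=x and y=y and p=s] by blast
  show "\<exists>p q s. poly s t0 \<noteq> 0 \<and>
      (\<forall>t. poly s t \<noteq> 0 \<longrightarrow> poly q t \<noteq> 0 \<and> f (?l t) = poly p t / poly q t)"
    using *(2,3) point_of_in_basic_open[OF *(1) line] mem_Union_basic_open[OF *(1)] line
    by (intro exI[of _ p1] exI[of _ q1] exI[of _ s1]) (simp add: p1 q1 s1)
qed (use that in blast)

text \<open>The degree bound comes from the behaviour at the point at infinity \<open>y\<close> of the line:
  \<open>f (x + t y) = t ^ d f (y + t\<^sup>-\<^sup>1 x)\<close>.\<close>

lemma twist_section_on_line_degree:
  assumes f: "f \<in> twist_sections n (int d) (proj_space n)"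
    and line: "\<And>t. (\<lambda>k. x k + t * y k) \<in> punctured_space n"
    and line': "\<And>t. (\<lambda>k. y k + t * x k) \<in> punctured_space n"
  obtains P where "degree P \<le> d" "\<And>t. f (\<lambda>k. x k + t * y k) = poly P t"
proof -
  obtain P where P: "\<And>t. f (\<lambda>k. x k + t * y k) = poly P t"
    using twist_section_on_line[OF f line] by blast
  obtain Q where Q: "\<And>t. f (\<lambda>k. y k + t * x k) = poly Q t"
    using twist_section_on_line[OF f line'] by blast
  have "poly P t = t ^ d * poly Q (inverse t)" if "t \<noteq> 0" for t
  proof -
    have "(\<lambda>k. x k + t * y k) = (\<lambda>k. t * (y k + inverse t * x k))"
      by (rule ext) (simp add: distrib_left that flip: mult.assoc)
    then show ?thesis
      using twist_sections_scale[OF f subset_refl, of "\<lambda>k. y k + inverse t * x k" t] that line'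
      by (simp only: Union_proj_space P[symmetric] Q[symmetric] simp_thms)
  qed
  \<comment> \<open>Clears denominators: \<open>t ^ degree Q * poly Q (inverse t)\<close> is the
    value of \<open>reflect_poly Q\<close>. The factor \<open>[:0, 1:]\<close> takes care of
    \<open>t = 0\<close>.\<close>
  then have "poly ([:0, 1:] * (monom 1 (degree Q) * P)) t
      = poly ([:0, 1:] * (monom 1 d * reflect_poly Q)) t" for t
    by (cases "t = 0") (auto simp: poly_monom poly_reflect_poly_nz)
  then have "[:0, 1:] * (monom 1 (degree Q) * P) = [:0, 1:] * (monom 1 d * reflect_poly Q)"
    by (intro poly_ext)
  then have eq: "monom 1 (degree Q) * P = monom 1 d * reflect_poly Q" by simp
  have "degree P \<le> d"
  proof (cases "P = 0")
    case False
    have "degree Q + degree P = degree (monom 1 (degree Q) * P)"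
      using False by (subst degree_mult_eq) (auto simp: degree_monom_eq)
    also have "\<dots> \<le> d + degree (reflect_poly Q)"
      unfolding eq by (rule order_trans[OF degree_mult_le]) (simp add: degree_monom_eq)
    also have "\<dots> \<le> d + degree Q" by (simp add: degree_reflect_poly_le)
    finally show ?thesis by simp
  qed simp
  then show ?thesis using that P by blast
qed

text \<open>The node \<open>0\<close> is avoided because a section is not defined at the origin.\<close>

definition lagrange :: "nat \<Rightarrow> nat \<Rightarrow> complex poly" where
  "lagrange d a = (\<Prod>b\<in>{..d} - {a}. smult (1 / (of_nat a - of_nat b)) [:- of_nat (Suc b), 1:])"

text \<open>Both sides have degree at most \<open>d\<close> and agree at the \<open>d + 1\<close>
  nodes. The coefficients do not depend on \<open>P\<close>, so the formula can be used in one
  variable while the others are parameters.\<close>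

lemma lagrange_interpolation:
  assumes "degree P \<le> d"
  shows "poly P t = (\<Sum>a\<le>d. poly (lagrange d a) t * poly P (of_nat (Suc a)))"
proof -
  let ?Q = "\<Sum>a\<le>d. smult (poly P (of_nat (Suc a))) (lagrange d a)"
  have deg: "degree (lagrange d a) \<le> d" if "a \<le> d" for a
  proof -
    have "degree (lagrange d a)
        \<le> (\<Sum>b\<in>{..d} - {a}. degree (smult (1 / (of_nat a - of_nat b)) [:- of_nat (Suc b), 1 :: complex:]))"
      unfolding lagrange_def by (rule degree_prod_sum_le[unfolded comp_def]) simp
    also have "\<dots> \<le> (\<Sum>b\<in>{..d} - {a}. 1)"
      by (rule sum_mono) (rule order_trans[OF degree_smult_le], simp)
    also have "\<dots> = d" using that by simp
    finally show ?thesis .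
  qed
  have val: "poly (lagrange d a) (of_nat (Suc c)) = (if a = c then 1 else 0)"
    if "a \<le> d" "c \<le> d" for a c
  proof (cases "a = c")
    case True
    have "poly (smult (1 / (of_nat c - of_nat b)) [:- of_nat (Suc b), 1:]) (of_nat (Suc c)) = (1 :: complex)"
      if "b \<noteq> c" for b
    proof -
      have "(of_nat c - of_nat b :: complex) \<noteq> 0" using that by simp
      then show ?thesis by (simp add: divide_simps)
    qed
    then have "poly (lagrange d c) (of_nat (Suc c)) = (\<Prod>b\<in>{..d} - {c}. 1)"
      unfolding lagrange_def poly_prod by (intro prod.cong) auto
    then show ?thesis using True by simp
  next
    case False
    have "poly (lagrange d a) (of_nat (Suc c)) = 0"
      unfolding lagrange_def poly_prod by (rule prod_zero) (use that False in \<open>auto intro!: bexI[of _ c] simp flip: add_divide_distrib\<close>)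
    then show ?thesis using False by simp
  qed
  have "P = ?Q"
  proof (rule poly_eqI_degree[of "(\<lambda>a. of_nat (Suc a)) ` {..d}"])
    fix x :: complex
    assume "x \<in> (\<lambda>a. of_nat (Suc a)) ` {..d}"
    then obtain c where c: "c \<le> d" "x = of_nat (Suc c)" by auto
    have "poly ?Q x = (\<Sum>a\<le>d. if a = c then poly P (of_nat (Suc a)) else 0)"
      unfolding poly_sum by (rule sum.cong) (use c val in \<open>auto simp del: of_nat_Suc\<close>)
    then show "poly P x = poly ?Q x" using c by (simp add: sum.delta del: of_nat_Suc)
  next
    have "card ((\<lambda>a. of_nat (Suc a) :: complex) ` {..d}) = Suc d"
      by (subst card_image) (auto intro!: inj_onI)
    then show "card ((\<lambda>a. of_nat (Suc a) :: complex) ` {..d}) > degree P"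
      "card ((\<lambda>a. of_nat (Suc a) :: complex) ` {..d}) > degree ?Q"
      using assms le_imp_less_Suc[OF degree_sum_le[of "{..d}" _ d]] deg
      by (auto intro!: le_imp_less_Suc degree_sum_le order_trans[OF degree_smult_le])
  qed
  then have "poly P t = poly ?Q t" by simp
  then show ?thesis by (simp add: poly_sum mult.commute del: of_nat_Suc)
qed

text \<open>With the polynomial kept existential, the interpolation formula is assembled from
  closure rules. Homogeneity is not asked for, because Lagrange factors are in general not
  homogeneous.\<close>

definition mpoly_function :: "nat \<Rightarrow> (vec \<Rightarrow> complex) \<Rightarrow> bool" where
  "mpoly_function n g \<longleftrightarrow> (\<exists>p. (\<forall>m\<in>Poly_Mapping.keys p. Poly_Mapping.keys m \<subseteq> {..n}) \<and>
     (\<forall>x. g x = mpoly_eval p x))"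

lemma mpoly_function_const: "mpoly_function n (\<lambda>x. c)"
  unfolding mpoly_function_def by (rule exI[of _ "Poly_Mapping.single 0 c"]) auto

lemma mpoly_function_coord: "k \<le> n \<Longrightarrow> mpoly_function n (\<lambda>x. x k)"
  unfolding mpoly_function_def
  by (rule exI[of _ "Poly_Mapping.single (Poly_Mapping.single k 1) 1"]) auto

lemma mpoly_function_add:
  assumes "mpoly_function n f" "mpoly_function n g"
  shows "mpoly_function n (\<lambda>x. f x + g x)"
proof -
  obtain p q where "\<forall>m\<in>Poly_Mapping.keys p. Poly_Mapping.keys m \<subseteq> {..n}" "\<forall>x. f x = mpoly_eval p x"
    "\<forall>m\<in>Poly_Mapping.keys q. Poly_Mapping.keys m \<subseteq> {..n}" "\<forall>x. g x = mpoly_eval q x"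
    using assms unfolding mpoly_function_def by blast
  then show ?thesis
    unfolding mpoly_function_def using keys_add[of p q]
    by (intro exI[of _ "p + q"] conjI ballI allI) (blast, simp add: mpoly_eval_add)
qed

lemma mpoly_function_mult:
  assumes "mpoly_function n f" "mpoly_function n g"
  shows "mpoly_function n (\<lambda>x. f x * g x)"
proof -
  obtain p q where "\<forall>m\<in>Poly_Mapping.keys p. Poly_Mapping.keys m \<subseteq> {..n}" "\<forall>x. f x = mpoly_eval p x"
    "\<forall>m\<in>Poly_Mapping.keys q. Poly_Mapping.keys m \<subseteq> {..n}" "\<forall>x. g x = mpoly_eval q x"
    using assms unfolding mpoly_function_def by blast
  moreover have "Poly_Mapping.keys m \<subseteq> {..n}" if m: "m \<in> Poly_Mapping.keys (p * q)" for m
  proof -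
    obtain a b where "m = a + b" "a \<in> Poly_Mapping.keys p" "b \<in> Poly_Mapping.keys q"
      using m keys_mult[of p q] by blast
    then show ?thesis using calculation by (simp add: keys_add_nat)
  qed
  ultimately show ?thesis
    unfolding mpoly_function_def by (intro exI[of _ "p * q"]) (auto simp: mpoly_eval_mult)
qed

lemma mpoly_function_sum:
  "(\<And>i. i \<in> I \<Longrightarrow> mpoly_function n (f i)) \<Longrightarrow> mpoly_function n (\<lambda>x. \<Sum>i\<in>I. f i x)"
  by (induction I rule: infinite_finite_induct)
    (auto intro: mpoly_function_add mpoly_function_const)

lemma mpoly_function_poly:
  "k \<le> n \<Longrightarrow> mpoly_function n (\<lambda>x. poly P (x k))"
  by (induction P)
    (auto intro!: mpoly_function_add mpoly_function_mult mpoly_function_const mpoly_function_coord)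

text \<open>Induction on the number \<open>r\<close> of variables on which \<open>g\<close> depends:
  interpolating in the last of them leaves coefficients that depend on one variable fewer and
  inherit the degree bound. The bound is uniform, so a single finite formula works for all
  \<open>x\<close>.\<close>

lemma mpoly_function_separately:
  assumes "\<And>x y. (\<And>k. k < r \<Longrightarrow> x k = y k) \<Longrightarrow> g x = g y"
    and "\<And>k x. k < r \<Longrightarrow> \<exists>P. degree P \<le> d \<and> (\<forall>t. g (x(k := t)) = poly P t)"
    and "r \<le> Suc n"
  shows "mpoly_function n g"
  using assms
proof (induction r arbitrary: g)
  case 0
  then have "g = (\<lambda>x. g (\<lambda>k. 0))" by auto
  then show ?case by (metis mpoly_function_const)
next
  case (Suc r)
  have "g x = (\<Sum>a\<le>d. poly (lagrange d a) (x r) * g (x(r := of_nat (Suc a))))" for x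
  proof -
    obtain P where P: "degree P \<le> d" "\<And>t. g (x(r := t)) = poly P t"
      using Suc.prems(2)[of r x] by blast
    have "g x = poly P (x r)" by (metis P(2) fun_upd_triv)
    also have "\<dots> = (\<Sum>a\<le>d. poly (lagrange d a) (x r) * poly P (of_nat (Suc a)))"
      by (rule lagrange_interpolation[OF P(1)])
    finally show ?thesis by (simp only: P(2))
  qed
  then have g: "g = (\<lambda>x. \<Sum>a\<le>d. poly (lagrange d a) (x r) * g (x(r := of_nat (Suc a))))" by (rule ext)
  have "mpoly_function n (\<lambda>x. g (x(r := c)))" for c
  proof (rule Suc.IH)
    show "g (x(r := c)) = g (y(r := c))" if "\<And>k. k < r \<Longrightarrow> x k = y k" for x y
      by (rule Suc.prems(1)) (use that in \<open>auto simp: less_Suc_eq\<close>)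
    show "\<exists>P. degree P \<le> d \<and> (\<forall>t. g ((x(k := t))(r := c)) = poly P t)" if "k < r" for k x
    proof -
      have "(x(k := t))(r := c) = (x(r := c))(k := t)" for t using that by auto
      then show ?thesis using Suc.prems(2)[of k "x(r := c)"] that by (simp only: less_SucI)
    qed
  next
    show "r \<le> Suc n" using Suc.prems(3) by simp
  qed
  then show ?case
    using Suc.prems(3) by (subst g) (intro mpoly_function_sum mpoly_function_mult mpoly_function_poly, simp_all)
qed

text \<open>The line runs in direction \<open>k\<close>. The nonzero coordinate \<open>l\<close>
  keeps it off the origin, and coordinate \<open>k\<close> does the same for the reversed line on
  which the degree bound rests.\<close>

lemma twist_section_polynomial_in_coord:
  assumes f: "f \<in> twist_sections n (int d) (proj_space n)"
    and x: "x \<in> punctured_space n" and k: "k \<le> n" and l: "l \<noteq> k" "x l \<noteq> 0"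
  obtains P where "degree P \<le> d" "\<And>t. f (x(k := t)) = poly P t"
proof -
  let ?x = "x(k := 0)" and ?y = "\<lambda>l. if l = k then 1 else 0 :: complex"
  have "(\<lambda>l. ?x l + t * ?y l) = x(k := t)" for t by auto
  moreover have "(\<lambda>l. ?x l + t * ?y l) \<in> punctured_space n" for t
    using x k l by (auto simp: punctured_space_def intro!: exI[of _ l])
  moreover have "(\<lambda>l. ?y l + t * ?x l) \<in> punctured_space n" for t
    using x k by (auto simp: punctured_space_def intro!: exI[of _ k])
  ultimately show ?thesis
    using twist_section_on_line_degree[OF f, of ?x ?y] that by metis
qed

text \<open>Since \<open>f\<close> has no value at the origin, coordinates cannot be varied freely.
  Freezing the last one at nonzero nodes frees the others; interpolating in the last one is then
  allowed wherever some other coordinate is nonzero.\<close>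

theorem global_section_homogeneous:
  assumes n: "n \<ge> 1" and f: "f \<in> twist_sections n (int d) (proj_space n)"
  obtains p where "homogeneous n d p" "\<And>x. x \<in> punctured_space n \<Longrightarrow> f x = mpoly_eval p x"
proof -
  \<comment> \<open>The entry \<open>of_nat (Suc a)\<close> is never zero, so the argument of
    \<open>f\<close> lies in the punctured space whatever the first \<open>n\<close> coordinates
    are.\<close>
  define h where "h a x = f (\<lambda>k. if k < n then x k else if k = n then of_nat (Suc a) else 0)"
    for a and x :: vec
  have h: "mpoly_function n (h a)" for a
  proof (rule mpoly_function_separately)
    show "h a x = h a y" if "\<And>k. k < n \<Longrightarrow> x k = y k" for x y
      unfolding h_def by (rule arg_cong[of _ _ f]) (use that in auto)
    show "\<exists>P. degree P \<le> d \<and> (\<forall>t. h a (x(k := t)) = poly P t)" if "k < n" for k x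
    proof -
      let ?x = "\<lambda>k. if k < n then x k else if k = n then of_nat (Suc a) else 0"
      have "?x \<in> punctured_space n"
        by (auto simp: punctured_space_def simp del: of_nat_Suc intro!: exI[of _ n])
      then obtain P where P: "degree P \<le> d" "\<And>t. f (?x(k := t)) = poly P t"
        using twist_section_polynomial_in_coord[OF f, of ?x k n] \<open>k < n\<close>
        by (metis (no_types, lifting) less_imp_le less_irrefl of_nat_neq_0)
      have "(\<lambda>l. if l < n then (x(k := t)) l else if l = n then of_nat (Suc a) else 0) = ?x(k := t)" for t
        using that by auto
      then show ?thesis using P unfolding h_def by auto
    qed
  qed auto
  have "mpoly_function n (\<lambda>x. \<Sum>a\<le>d. poly (lagrange d a) (x n) * h a x)"
    by (intro mpoly_function_sum mpoly_function_mult mpoly_function_poly h) simp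
  then obtain p where vars: "\<And>m. m \<in> Poly_Mapping.keys p \<Longrightarrow> Poly_Mapping.keys m \<subseteq> {..n}"
    and p: "\<And>x. (\<Sum>a\<le>d. poly (lagrange d a) (x n) * h a x) = mpoly_eval p x"
    unfolding mpoly_function_def by blast
  have generic: "f x = mpoly_eval p x" if x: "x \<in> punctured_space n" and k: "k < n" "x k \<noteq> 0" for x k
  proof -
    obtain P where P: "degree P \<le> d" "\<And>t. f (x(n := t)) = poly P t"
      using twist_section_polynomial_in_coord[OF f x, of n k] k by auto
    have "f x = poly P (x n)" by (metis P(2) fun_upd_triv)
    also have "\<dots> = (\<Sum>a\<le>d. poly (lagrange d a) (x n) * poly P (of_nat (Suc a)))"
      by (rule lagrange_interpolation[OF P(1)])
    also have "\<dots> = (\<Sum>a\<le>d. poly (lagrange d a) (x n) * h a x)"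
    proof -
      have "x(n := c) = (\<lambda>k. if k < n then x k else if k = n then c else 0)" for c
        using x by (auto simp: punctured_space_def)
      then show ?thesis by (simp only: h_def P(2)[symmetric])
    qed
    finally show ?thesis unfolding p .
  qed
  have fp: "f x = mpoly_eval p x" if x: "x \<in> punctured_space n" for x
  proof (cases "\<exists>k<n. x k \<noteq> 0")
    case True
    then show ?thesis using generic x by blast
  next
    case False
    obtain l where "x l \<noteq> 0" "\<forall>k>n. x k = 0" using x by (auto simp: punctured_space_def)
    then have xn: "x n \<noteq> 0" using False by (cases l n rule: linorder_cases) auto
    \<comment> \<open>The remaining points lie on the last coordinate axis. Moving in direction
      \<open>0\<close>, which differs from \<open>n\<close> as \<open>n \<ge> 1\<close>, leaves the
      axis: \<open>f\<close> and \<open>p\<close> are polynomial in \<open>t\<close> and agree for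
      \<open>t \<noteq> 0\<close>, hence also at \<open>0\<close>.\<close>
    obtain P where P: "\<And>t. f (x(0 := t)) = poly P t"
      using twist_section_polynomial_in_coord[OF f x, of 0 n] xn n by auto
    obtain Q where Q: "\<And>t. poly Q t = mpoly_eval p (\<lambda>k. (x(0 := 0)) k + t * (if k = 0 then 1 else 0))"
      using mpoly_eval_on_line by metis
    have line: "(\<lambda>k. (x(0 := 0)) k + t * (if k = 0 then 1 else 0)) = x(0 := t)" for t by auto
    have "poly ([:0, 1:] * P) t = poly ([:0, 1:] * Q) t" for t
    proof (cases "t = 0")
      case False
      have "x(0 := t) \<in> punctured_space n"
        using x False by (auto simp: punctured_space_def intro!: exI[of _ 0])
      then have "f (x(0 := t)) = mpoly_eval p (x(0 := t))"
        using generic[of _ 0] False n by auto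
      then show ?thesis using P Q[unfolded line] by simp
    qed simp
    then have "[:0, 1:] * P = [:0, 1:] * Q" by (intro poly_ext)
    then have "P = Q" by simp
    then show ?thesis using P[of "x 0"] Q[of "x 0", unfolded line] by simp
  qed
  \<comment> \<open>The interpolated \<open>p\<close> need not be homogeneous, but on the punctured
    space it scales like \<open>f\<close>, so its part of degree \<open>d\<close> has the same
    values there.\<close>
  obtain q where q: "homogeneous n d q"
    "\<And>x. (\<And>s. s \<noteq> 0 \<Longrightarrow> mpoly_eval p (\<lambda>k. s * x k) = s ^ d * mpoly_eval p x) \<Longrightarrow>
      mpoly_eval q x = mpoly_eval p x"
    using homogeneous_part_eval[OF vars] by blast
  show ?thesis
  proof (rule that[OF q(1)])
    fix x assume x: "x \<in> punctured_space n"
    have "mpoly_eval p (\<lambda>k. s * x k) = s ^ d * mpoly_eval p x" if "s \<noteq> 0" for s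
      using twist_sections_scale[OF f subset_refl _ that, of x] x fp punctured_space_scale[OF x that]
      by (simp add: Union_proj_space)
    then show "f x = mpoly_eval q x" using q(2) fp[OF x] by simp
  qed
qed

section \<open>The twisting sheaves are coherent\<close>

lemma twist_sections_extensional: "f \<in> twist_sections n d U \<Longrightarrow> f \<in> extensional (\<Union>U)"
  by (simp add: twist_sections_def)

lemma twist_sectionsE:
  assumes "f \<in> twist_sections n d U" "P \<in> U"
  obtains V p q a b where "zariski_open n V" "P \<in> V" "V \<subseteq> U" "homogeneous n a p" "homogeneous n b q"
    "int a - int b = d" "\<And>x. x \<in> \<Union>V \<Longrightarrow> mpoly_eval q x \<noteq> 0 \<and> f x = mpoly_eval p x / mpoly_eval q x"
  using assms unfolding twist_sections_def by blast

lemma twist_sectionsI: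
  assumes "f \<in> extensional (\<Union>U)"
    and "\<And>P. P \<in> U \<Longrightarrow> \<exists>V p q a b. zariski_open n V \<and> P \<in> V \<and> V \<subseteq> U \<and>
        homogeneous n a p \<and> homogeneous n b q \<and> int a - int b = d \<and>
        (\<forall>x\<in>\<Union>V. mpoly_eval q x \<noteq> 0 \<and> f x = mpoly_eval p x / mpoly_eval q x)"
  shows "f \<in> twist_sections n d U"
  using assms by (auto simp: twist_sections_def)

section \<open>Operations on sections\<close>

lemma twist_sections_add:
  assumes "f \<in> twist_sections n d U" "g \<in> twist_sections n d U"
  shows "(\<lambda>x\<in>\<Union>U. f x + g x) \<in> twist_sections n d U"
proof (rule twist_sectionsI)
  fix P assume P: "P \<in> U"
  obtain V p q a b where V: "zariski_open n V" "P \<in> V" "V \<subseteq> U" "homogeneous n a p" "homogeneous n b q"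
    "int a - int b = d" "\<And>x. x \<in> \<Union>V \<Longrightarrow> mpoly_eval q x \<noteq> 0 \<and> f x = mpoly_eval p x / mpoly_eval q x"
    by (rule twist_sectionsE[OF assms(1) P]) (rule that)
  obtain W r s a' b' where W: "zariski_open n W" "P \<in> W" "W \<subseteq> U" "homogeneous n a' r" "homogeneous n b' s"
    "int a' - int b' = d" "\<And>x. x \<in> \<Union>W \<Longrightarrow> mpoly_eval s x \<noteq> 0 \<and> g x = mpoly_eval r x / mpoly_eval s x"
    by (rule twist_sectionsE[OF assms(2) P]) (rule that)
  have "homogeneous n (a' + b) (r * q)" by (intro homogeneous_mult V W)
  \<comment> \<open>Both fractions have degree \<open>d\<close>, so the two cross products in the
    numerator have the same degree.\<close>
  moreover have "a' + b = a + b'" using V(6) W(6) by simp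
  ultimately have "homogeneous n (a + b') (p * s + r * q)"
    using homogeneous_mult[OF V(4) W(5)] by (simp add: homogeneous_add)
  moreover have "mpoly_eval (q * s) x \<noteq> 0 \<and>
      (\<lambda>x\<in>\<Union>U. f x + g x) x = mpoly_eval (p * s + r * q) x / mpoly_eval (q * s) x"
    if "x \<in> \<Union>(V \<inter> W)" for x
  proof -
    have "x \<in> \<Union>V" "x \<in> \<Union>W" "x \<in> \<Union>U" using that V(3) by auto
    then show ?thesis using V(7) W(7)
      by (simp add: mpoly_eval_add mpoly_eval_mult add_frac_eq)
  qed
  ultimately show "\<exists>V p q a b. zariski_open n V \<and> P \<in> V \<and> V \<subseteq> U \<and>
      homogeneous n a p \<and> homogeneous n b q \<and> int a - int b = d \<and>
      (\<forall>x\<in>\<Union>V. mpoly_eval q x \<noteq> 0 \<and> (\<lambda>x\<in>\<Union>U. f x + g x) x = mpoly_eval p x / mpoly_eval q x)"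
    using zariski_open_Int[OF V(1) W(1)] V(2,3,6) W(2,6) homogeneous_mult[OF V(5) W(5)]
    by (intro exI[of _ "V \<inter> W"] exI[of _ "p * s + r * q"] exI[of _ "q * s"]
        exI[of _ "a + b'"] exI[of _ "b + b'"] conjI ballI) auto
qed simp

lemma twist_sections_mult:
  assumes "f \<in> twist_sections n d U" "g \<in> twist_sections n e U"
  shows "(\<lambda>x\<in>\<Union>U. f x * g x) \<in> twist_sections n (d + e) U"
proof (rule twist_sectionsI)
  fix P assume P: "P \<in> U"
  obtain V p q a b where V: "zariski_open n V" "P \<in> V" "V \<subseteq> U" "homogeneous n a p" "homogeneous n b q"
    "int a - int b = d" "\<And>x. x \<in> \<Union>V \<Longrightarrow> mpoly_eval q x \<noteq> 0 \<and> f x = mpoly_eval p x / mpoly_eval q x"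
    by (rule twist_sectionsE[OF assms(1) P]) (rule that)
  obtain W r s a' b' where W: "zariski_open n W" "P \<in> W" "W \<subseteq> U" "homogeneous n a' r" "homogeneous n b' s"
    "int a' - int b' = e" "\<And>x. x \<in> \<Union>W \<Longrightarrow> mpoly_eval s x \<noteq> 0 \<and> g x = mpoly_eval r x / mpoly_eval s x"
    by (rule twist_sectionsE[OF assms(2) P]) (rule that)
  have "mpoly_eval (q * s) x \<noteq> 0 \<and>
      (\<lambda>x\<in>\<Union>U. f x * g x) x = mpoly_eval (p * r) x / mpoly_eval (q * s) x"
    if "x \<in> \<Union>(V \<inter> W)" for x
  proof -
    have "x \<in> \<Union>V" "x \<in> \<Union>W" "x \<in> \<Union>U" using that V(3) by auto
    then show ?thesis using V(7) W(7) by (simp add: mpoly_eval_mult)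
  qed
  then show "\<exists>V p q a b. zariski_open n V \<and> P \<in> V \<and> V \<subseteq> U \<and>
      homogeneous n a p \<and> homogeneous n b q \<and> int a - int b = d + e \<and>
      (\<forall>x\<in>\<Union>V. mpoly_eval q x \<noteq> 0 \<and> (\<lambda>x\<in>\<Union>U. f x * g x) x = mpoly_eval p x / mpoly_eval q x)"
    using zariski_open_Int[OF V(1) W(1)] V(2,3,6) W(2,6)
      homogeneous_mult[OF V(4) W(4)] homogeneous_mult[OF V(5) W(5)]
    by (intro exI[of _ "V \<inter> W"] exI[of _ "p * r"] exI[of _ "q * s"]
        exI[of _ "a + a'"] exI[of _ "b + b'"] conjI ballI) auto
qed simp

lemma twist_sections_fraction:
  assumes "zariski_open n U" "homogeneous n a p" "homogeneous n b q"
    and "\<And>x. x \<in> \<Union>U \<Longrightarrow> mpoly_eval q x \<noteq> 0"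
  shows "(\<lambda>x\<in>\<Union>U. mpoly_eval p x / mpoly_eval q x) \<in> twist_sections n (int a - int b) U"
proof (rule twist_sectionsI)
  fix P assume "P \<in> U"
  then show "\<exists>V p' q' a' b'. zariski_open n V \<and> P \<in> V \<and> V \<subseteq> U \<and>
      homogeneous n a' p' \<and> homogeneous n b' q' \<and> int a' - int b' = int a - int b \<and>
      (\<forall>x\<in>\<Union>V. mpoly_eval q' x \<noteq> 0 \<and>
        (\<lambda>x\<in>\<Union>U. mpoly_eval p x / mpoly_eval q x) x = mpoly_eval p' x / mpoly_eval q' x)"
    using assms by (intro exI[of _ U] exI[of _ p] exI[of _ q] exI[of _ a] exI[of _ b]) simp
qed simp

lemma twist_sections_homogeneous:
  assumes "zariski_open n U" "homogeneous n d p"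
  shows "(\<lambda>x\<in>\<Union>U. mpoly_eval p x) \<in> twist_sections n (int d) U"
  using twist_sections_fraction[OF assms homogeneous_1] by simp

lemma twist_sections_const: "zariski_open n U \<Longrightarrow> (\<lambda>x\<in>\<Union>U. c) \<in> twist_sections n 0 U"
  using twist_sections_homogeneous[OF _ homogeneous_const, of n U c] by simp

lemma twist_sections_zero: "zariski_open n U \<Longrightarrow> (\<lambda>x\<in>\<Union>U. 0) \<in> twist_sections n (int d) U"
  using twist_sections_homogeneous[OF _ homogeneous_0, of n U d] by simp

lemma twist_sections_smult:
  assumes "r \<in> twist_sections n 0 U" "f \<in> twist_sections n d U"
  shows "(\<lambda>x\<in>\<Union>U. r x * f x) \<in> twist_sections n d U"
  using twist_sections_mult[OF assms] by simp

lemma twist_sections_scalar: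
  assumes "zariski_open n U" "f \<in> twist_sections n d U"
  shows "(\<lambda>x\<in>\<Union>U. c * f x) \<in> twist_sections n d U"
  using twist_sections_smult[OF twist_sections_const[OF assms(1), of c] assms(2)]
  by (simp cong: restrict_cong)

lemma twist_sections_restrict:
  assumes "zariski_open n V" "V \<subseteq> U" "f \<in> twist_sections n d U"
  shows "restrict f (\<Union>V) \<in> twist_sections n d V"
proof (rule twist_sectionsI)
  fix P assume P: "P \<in> V"
  then obtain W p q a b where W: "zariski_open n W" "P \<in> W" "homogeneous n a p" "homogeneous n b q"
    "int a - int b = d" "\<And>x. x \<in> \<Union>W \<Longrightarrow> mpoly_eval q x \<noteq> 0 \<and> f x = mpoly_eval p x / mpoly_eval q x"
    using twist_sectionsE[OF assms(3)] assms(2) by (metis subsetD)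
  have "mpoly_eval q x \<noteq> 0 \<and> restrict f (\<Union>V) x = mpoly_eval p x / mpoly_eval q x"
    if "x \<in> \<Union>(V \<inter> W)" for x
  proof -
    have "x \<in> \<Union>V" "x \<in> \<Union>W" using that by auto
    then show ?thesis using W(6) by simp
  qed
  then show "\<exists>W p q a b. zariski_open n W \<and> P \<in> W \<and> W \<subseteq> V \<and>
      homogeneous n a p \<and> homogeneous n b q \<and> int a - int b = d \<and>
      (\<forall>x\<in>\<Union>W. mpoly_eval q x \<noteq> 0 \<and> restrict f (\<Union>V) x = mpoly_eval p x / mpoly_eval q x)"
    using zariski_open_Int[OF assms(1) W(1)] P W(2-5)
    by (intro exI[of _ "V \<inter> W"] exI[of _ p] exI[of _ q] exI[of _ a] exI[of _ b]) auto
qed simp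

section \<open>Ring, module and sheaf axioms\<close>

lemma cring_structure_ring:
  assumes U: "zariski_open n U"
  shows "cring (structure_ring n U)"
proof (rule cringI)
  note ext = extensionalityI[where A = "\<Union>U"]
  show "abelian_group (structure_ring n U)"
  proof (rule abelian_groupI)
    fix f assume f: "f \<in> carrier (structure_ring n U)"
    show "\<exists>g\<in>carrier (structure_ring n U). g \<oplus>\<^bsub>structure_ring n U\<^esub> f = \<zero>\<^bsub>structure_ring n U\<^esub>"
      using f twist_sections_scalar[OF U, of f 0 "-1"]
      by (intro bexI[of _ "\<lambda>x\<in>\<Union>U. - 1 * f x"]) (auto simp: structure_ring_def intro!: ext)
  qed (use U in \<open>auto simp: structure_ring_def twist_sections_add twist_sections_const
      twist_sections_extensional intro!: ext\<close>)
  show "Group.comm_monoid (structure_ring n U)"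
    by (rule comm_monoidI) (use U in \<open>auto simp: structure_ring_def twist_sections_smult
        twist_sections_const twist_sections_extensional intro!: ext\<close>)
qed (auto simp: structure_ring_def algebra_simps intro!: extensionalityI[where A = "\<Union>U"])

lemma twist_simps [simp]:
  "sec (twist n d) U = twist_sections n d U"
  "\<zero>\<^bsub>sections (twist n d) U\<^esub> = (\<lambda>x\<in>\<Union>U. 0)"
  "f \<oplus>\<^bsub>sections (twist n d) U\<^esub> g = (\<lambda>x\<in>\<Union>U. f x + g x)"
  "r \<odot>\<^bsub>sections (twist n d) U\<^esub> f = (\<lambda>x\<in>\<Union>U. r x * f x)"
  "restr (twist n d) U V f = restrict f (\<Union>V)"
  by (simp_all add: twist_def)

lemma structure_ring_simps [simp]:
  "carrier (structure_ring n U) = twist_sections n 0 U"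
  "\<zero>\<^bsub>structure_ring n U\<^esub> = (\<lambda>x\<in>\<Union>U. 0)"
  "\<one>\<^bsub>structure_ring n U\<^esub> = (\<lambda>x\<in>\<Union>U. 1)"
  "f \<oplus>\<^bsub>structure_ring n U\<^esub> g = (\<lambda>x\<in>\<Union>U. f x + g x)"
  "f \<otimes>\<^bsub>structure_ring n U\<^esub> g = (\<lambda>x\<in>\<Union>U. f x * g x)"
  by (simp_all add: structure_ring_def)

lemma abelian_group_twist:
  assumes U: "zariski_open n U"
  shows "abelian_group (sections (twist n (int d)) U)"
proof (rule abelian_groupI)
  fix f assume f: "f \<in> sec (twist n (int d)) U"
  show "\<exists>g\<in>sec (twist n (int d)) U.
      g \<oplus>\<^bsub>sections (twist n (int d)) U\<^esub> f = \<zero>\<^bsub>sections (twist n (int d)) U\<^esub>"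
    using f twist_sections_scalar[OF U, of f "int d" "-1"]
    by (intro bexI[of _ "\<lambda>x\<in>\<Union>U. - 1 * f x"]) (auto intro!: extensionalityI[where A = "\<Union>U"])
qed (use U in \<open>auto simp: twist_sections_add twist_sections_zero twist_sections_extensional
    intro!: extensionalityI[where A = "\<Union>U"]\<close>)

lemma module_twist:
  assumes U: "zariski_open n U"
  shows "Module.module (structure_ring n U) (sections (twist n (int d)) U)"
  by (rule moduleI[OF cring_structure_ring[OF U] abelian_group_twist[OF U]])
    (auto simp: twist_sections_smult twist_sections_extensional algebra_simps
      intro!: extensionalityI[where A = "\<Union>U"])

lemma sheaf_of_modules_twist: "sheaf_of_modules n (twist n (int d))"
proof (rule sheaf_of_modules.intro)
  fix \<U> and \<sigma> :: "point set \<Rightarrow> vec \<Rightarrow> complex"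
  assume op: "\<And>V. V \<in> \<U> \<Longrightarrow> zariski_open n V"
    and sec: "\<And>V. V \<in> \<U> \<Longrightarrow> \<sigma> V \<in> sec (twist n (int d)) V"
    and compat: "\<And>V W. \<lbrakk>V \<in> \<U>; W \<in> \<U>\<rbrakk> \<Longrightarrow>
      restr (twist n (int d)) V (V \<inter> W) (\<sigma> V) = restr (twist n (int d)) W (V \<inter> W) (\<sigma> W)"
  \<comment> \<open>The value at \<open>x\<close> is read off from an arbitrary member whose cone
    contains \<open>x\<close>; compatibility makes the choice irrelevant.\<close>
  define t where "t = (\<lambda>x\<in>\<Union>(\<Union>\<U>). \<sigma> (SOME V. V \<in> \<U> \<and> x \<in> \<Union>V) x)"
  have t: "t x = \<sigma> V x" if V: "V \<in> \<U>" "x \<in> \<Union>V" for V x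
  proof -
    define W where "W = (SOME V. V \<in> \<U> \<and> x \<in> \<Union>V)"
    have W: "W \<in> \<U>" "x \<in> \<Union>W"
      using someI[of "\<lambda>V. V \<in> \<U> \<and> x \<in> \<Union>V" V] V unfolding W_def by auto
    \<comment> \<open>Cones meet in the cone over the intersection because \<open>x\<close>
      determines its point.\<close>
    have "x \<in> \<Union>(V \<inter> W)"
      using V(2) W(2) mem_Union_iff[OF zariski_open_subset[OF op[OF V(1)]], of x]
        mem_Union_iff[OF zariski_open_subset[OF op[OF W(1)]], of x] mem_point_of[of x] by auto
    then have "\<sigma> V x = \<sigma> W x" using fun_cong[OF compat[OF V(1) W(1)], of x] by simp
    moreover have "x \<in> \<Union>(\<Union>\<U>)" using V by auto
    ultimately show ?thesis by (simp add: t_def W_def)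
  qed
  show "\<exists>!t. t \<in> sec (twist n (int d)) (\<Union>\<U>) \<and> (\<forall>V\<in>\<U>. restr (twist n (int d)) (\<Union>\<U>) V t = \<sigma> V)"
  proof (rule ex1I[of _ t], intro conjI ballI)
    show "t \<in> sec (twist n (int d)) (\<Union>\<U>)"
      unfolding twist_simps
    proof (rule twist_sectionsI)
      fix P assume "P \<in> \<Union>\<U>"
      then obtain V where V: "V \<in> \<U>" "P \<in> V" by blast
      have "\<sigma> V \<in> twist_sections n (int d) V" using sec[OF V(1)] by simp
      from this V(2) obtain W p q a b where W: "zariski_open n W" "P \<in> W" "W \<subseteq> V" "homogeneous n a p"
        "homogeneous n b q" "int a - int b = int d"
        "\<And>x. x \<in> \<Union>W \<Longrightarrow> mpoly_eval q x \<noteq> 0 \<and> \<sigma> V x = mpoly_eval p x / mpoly_eval q x"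
        by (rule twist_sectionsE) (rule that)
      have "t x = \<sigma> V x" if "x \<in> \<Union>W" for x using that W(3) by (intro t V(1)) auto
      then show "\<exists>W p q a b. zariski_open n W \<and> P \<in> W \<and> W \<subseteq> \<Union>\<U> \<and>
          homogeneous n a p \<and> homogeneous n b q \<and> int a - int b = int d \<and>
          (\<forall>x\<in>\<Union>W. mpoly_eval q x \<noteq> 0 \<and> t x = mpoly_eval p x / mpoly_eval q x)"
        using W V(1)
        by (intro exI[of _ W] exI[of _ p] exI[of _ q] exI[of _ a] exI[of _ b]) auto
    qed (simp add: t_def)
    show "restr (twist n (int d)) (\<Union>\<U>) V t = \<sigma> V" if "V \<in> \<U>" for V
      using sec[OF that] t[OF that]
      by (auto intro!: extensionalityI[where A = "\<Union>V"]
          intro: twist_sections_extensional[where n = n and d = "int d"])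
  next
    fix t' assume t': "t' \<in> sec (twist n (int d)) (\<Union>\<U>) \<and>
      (\<forall>V\<in>\<U>. restr (twist n (int d)) (\<Union>\<U>) V t' = \<sigma> V)"
    show "t' = t"
    proof (rule extensionalityI[where A = "\<Union>(\<Union>\<U>)"])
      fix x assume "x \<in> \<Union>(\<Union>\<U>)"
      then obtain V where V: "V \<in> \<U>" "x \<in> \<Union>V" by blast
      have "restrict t' (\<Union>V) = \<sigma> V" using t' V(1) by simp
      from fun_cong[OF this, of x] show "t' x = t x" using t[OF V] V(2) by simp
    qed (use t' in \<open>auto simp: t_def intro: twist_sections_extensional\<close>)
  qed
next
  fix U V s assume UV: "zariski_open n U" "zariski_open n V" "V \<subseteq> U" and s: "s \<in> sec (twist n (int d)) U"
  show "restr (twist n (int d)) U V s \<in> sec (twist n (int d)) V"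
    using UV s by (simp add: twist_sections_restrict)
  have sub: "\<Union>V \<subseteq> \<Union>U" using UV by auto
  show "restr (twist n (int d)) U V (s \<oplus>\<^bsub>sections (twist n (int d)) U\<^esub> t) =
      restr (twist n (int d)) U V s \<oplus>\<^bsub>sections (twist n (int d)) V\<^esub> restr (twist n (int d)) U V t" for t
    unfolding twist_simps
    by (rule extensionalityI[where A = "\<Union>V"], rule restrict_extensional, rule restrict_extensional)
      (use subsetD[OF sub] in \<open>simp_all del: Union_iff\<close>)
  show "restr (twist n (int d)) U V (r \<odot>\<^bsub>sections (twist n (int d)) U\<^esub> s) =
      structure_restr V r \<odot>\<^bsub>sections (twist n (int d)) V\<^esub> restr (twist n (int d)) U V s" for r
    unfolding twist_simps
    by (rule extensionalityI[where A = "\<Union>V"], rule restrict_extensional, rule restrict_extensional)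
      (use subsetD[OF sub] in \<open>simp_all add: structure_restr_def del: Union_iff\<close>)
  show "restr (twist n (int d)) V W (restr (twist n (int d)) U V s) = restr (twist n (int d)) U W s"
    if "W \<subseteq> V" for W
  proof -
    have "\<Union>V \<inter> \<Union>W = \<Union>W" using that by auto
    then show ?thesis by simp
  qed
next
  fix U s assume "s \<in> sec (twist n (int d)) U"
  then show "restr (twist n (int d)) U U s = s"
    by (simp add: twist_sections_extensional extensional_restrict)
qed (rule module_twist)

text \<open>On the chart where \<open>x k \<noteq> 0\<close> the sheaf is free of rank one with generator \<open>x k ^ d\<close>.\<close>

lemma coherent_twist: "coherent n (twist n (int d))"
  unfolding coherent_def
proof (intro conjI ballI)
  let ?F = "twist n (int d)"
  fix P assume "P \<in> proj_space n"
  then obtain y where y: "y \<in> punctured_space n" "P = point_of y" by (rule proj_spaceE)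
  then obtain k where k: "y k \<noteq> 0" "k \<le> n" unfolding punctured_space_def by force
  define X where "X e = (Poly_Mapping.single (Poly_Mapping.single k e) 1 :: mpoly)" for e
  have X: "homogeneous n e (X e)" for e
    unfolding X_def by (intro homogeneous_single single_in_monomials k)
  have eX: "mpoly_eval (X e) x = x k ^ e" for e x by (simp add: X_def)
  define U where "U = basic_open n (X 1)"
  have U: "zariski_open n U" unfolding U_def by (rule zariski_open_basic_open[OF X])
  have nz: "x k \<noteq> 0" if "x \<in> \<Union>U" for x
    using that unfolding U_def mem_Union_basic_open[OF X] by (simp add: eX)
  have PU: "P \<in> U" using k y unfolding U_def by (simp add: point_of_in_basic_open[OF X] eX)
  define s where "s = (\<lambda>x\<in>\<Union>U. x k ^ d)"
  have s: "s \<in> twist_sections n (int d) U"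
    using twist_sections_homogeneous[OF U X, of d] by (simp add: s_def eX)
  \<comment> \<open>\<open>locally_presented\<close> sums over generators; with a single generator
    the sum collapses.\<close>
  have one: "finsum (sections ?F V) g {..<1::nat} = g 0"
    if "zariski_open n V" "g 0 \<in> twist_sections n (int d) V" for V and g :: "nat \<Rightarrow> vec \<Rightarrow> complex"
  proof -
    interpret abelian_group "sections ?F V" by (rule abelian_group_twist) fact
    have "finsum (sections ?F V) g (insert 0 {}) = g 0"
      using that by (subst finsum_insert) (auto simp: twist_sections_extensional
          intro!: extensionalityI[where A = "\<Union>V"])
    then show ?thesis by (simp add: lessThan_Suc)
  qed
  have rs: "restrict s (\<Union>V) \<in> twist_sections n (int d) V" if "zariski_open n V" "V \<subseteq> U" for V
    using that s by (intro twist_sections_restrict)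
  \<comment> \<open>One generator and no relations. Surjectivity is division by
    \<open>x k ^ d\<close>; the kernel is trivial because this function has no zero on the
    chart.\<close>
  have "locally_presented n ?F U 1 (\<lambda>_. s) 0 (\<lambda>_ _ _. 0)"
    unfolding locally_presented_def
  proof (intro conjI allI impI)
    fix V t Q
    assume V: "zariski_open n V \<and> V \<subseteq> U \<and> t \<in> sec ?F V \<and> Q \<in> V"
    \<comment> \<open>The coefficient is \<open>t x / x k ^ d\<close>, written as a product of
      sections of degrees \<open>d\<close> and \<open>- d\<close>, so that it is a regular
      function.\<close>
    define f where "f = (\<lambda>x\<in>\<Union>V. t x * (\<lambda>x\<in>\<Union>V. mpoly_eval 1 x / mpoly_eval (X d) x) x)"
    have "x k \<noteq> 0" if "x \<in> \<Union>V" for x using that V nz by blast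
    then have "(\<lambda>x\<in>\<Union>V. mpoly_eval 1 x / mpoly_eval (X d) x) \<in> twist_sections n (int 0 - int d) V"
      using V by (intro twist_sections_fraction X homogeneous_1) (auto simp: eX)
    then have f: "f \<in> twist_sections n 0 V"
      unfolding f_def using twist_sections_mult[of t n "int d" V] V by fastforce
    define g where "g = (\<lambda>x\<in>\<Union>V. f x * restrict s (\<Union>V) x)"
    have g: "g \<in> twist_sections n (int d) V"
      unfolding g_def using V by (intro twist_sections_smult f rs) simp_all
    have "restrict t (\<Union>V) = g"
    proof (rule extensionalityI[where A = "\<Union>V"])
      show "restrict t (\<Union>V) x = g x" if "x \<in> \<Union>V" for x
      proof -
        have "x \<in> \<Union>U" using that V by auto
        then show ?thesis using that nz[of x] by (simp add: f_def g_def s_def eX)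
      qed
    qed (simp_all add: g_def)
    also have "g = (\<Oplus>\<^bsub>sections ?F V\<^esub>k\<in>{..<1::nat}. g)"
      by (rule one[symmetric]) (use g V in simp_all)
    finally have "restr ?F V V t = (\<Oplus>\<^bsub>sections ?F V\<^esub>k\<in>{..<1::nat}. f \<odot>\<^bsub>sections ?F V\<^esub> restr ?F U V s)"
      unfolding twist_simps g_def .
    then show "\<exists>W f. zariski_open n W \<and> Q \<in> W \<and> W \<subseteq> V \<and>
           (\<forall>k<1. f k \<in> carrier (structure_ring n W)) \<and>
           restr ?F V W t = (\<Oplus>\<^bsub>sections ?F W\<^esub>k\<in>{..<1::nat}. f k \<odot>\<^bsub>sections ?F W\<^esub> restr ?F U W s)"
      using V f by (intro exI[of _ V] exI[of _ "\<lambda>_. f"])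
        (simp only: structure_ring_simps simp_thms subset_refl)
  next
    fix V f Q
    assume V: "zariski_open n V \<and> V \<subseteq> U \<and> Q \<in> V \<and> (\<forall>k<1. f k \<in> carrier (structure_ring n V)) \<and>
      (\<Oplus>\<^bsub>sections ?F V\<^esub>k\<in>{..<1::nat}. f k \<odot>\<^bsub>sections ?F V\<^esub> restr ?F U V s) = \<zero>\<^bsub>sections ?F V\<^esub>"
    have f0: "f 0 \<in> twist_sections n 0 V" using V by simp
    have "(\<lambda>x\<in>\<Union>V. f 0 x * restrict s (\<Union>V) x) \<in> twist_sections n (int d) V"
      using V by (intro twist_sections_smult f0 rs) simp_all
    then have "(\<lambda>x\<in>\<Union>V. f 0 x * restrict s (\<Union>V) x) = (\<lambda>x\<in>\<Union>V. 0)"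
      using V one[of V "\<lambda>k. f k \<odot>\<^bsub>sections ?F V\<^esub> restr ?F U V s"] by simp
    then have z: "f 0 x * s x = 0" if "x \<in> \<Union>V" for x
      using that by (metis (no_types, lifting) restrict_apply')
    have "f 0 x = 0" if "x \<in> \<Union>V" for x
    proof -
      have "x \<in> \<Union>U" using V that by auto
      then have "s x \<noteq> 0" using nz by (simp add: s_def)
      then show ?thesis using z[OF that] by simp
    qed
    then have "structure_restr V (f 0) = (\<lambda>x\<in>\<Union>V. 0)"
      by (auto simp: structure_restr_def intro!: restrict_ext)
    moreover have "finsum (structure_ring n V) g {..<0::nat} = (\<lambda>x\<in>\<Union>V. 0)" for g
    proof -
      interpret cring "structure_ring n V" using V by (intro cring_structure_ring) simp
      show ?thesis by simp
    qed
    ultimately show "\<exists>W g. zariski_open n W \<and> Q \<in> W \<and> W \<subseteq> V \<and>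
           (\<forall>l<0. g l \<in> carrier (structure_ring n W)) \<and>
           (\<forall>k<1. structure_restr W (f k) =
              (\<Oplus>\<^bsub>structure_ring n W\<^esub>l\<in>{..<0::nat}. g l \<otimes>\<^bsub>structure_ring n W\<^esub> structure_restr W (\<lambda>_. 0)))"
      using V by (intro exI[of _ V] exI[of _ "\<lambda>_ _. 0"]) simp
  qed (use s in simp_all)
  then show "\<exists>U b s a \<rho>. zariski_open n U \<and> P \<in> U \<and> locally_presented n ?F U b s a \<rho>"
    using U PU by blast
qed (rule sheaf_of_modules_twist)

section \<open>Shadows of sets of monomials\<close>

abbreviation var :: "nat \<Rightarrow> nat \<Rightarrow>\<^sub>0 nat" where
  "var k \<equiv> Poly_Mapping.single k 1"

text \<open>The upper shadow in the divisibility order of monomials, as in extremal combinatorics of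
  multisets.\<close>

definition shadow :: "nat \<Rightarrow> (nat \<Rightarrow>\<^sub>0 nat) set \<Rightarrow> (nat \<Rightarrow>\<^sub>0 nat) set" where
  "shadow n M = (\<lambda>(m, k). m + var k) ` (M \<times> {..n})"

lemma lookup_monomials_degree:
  assumes "m \<in> monomials n d"
  shows "(\<Sum>k\<le>n. Poly_Mapping.lookup m k) = d"
  using assms mono_degree_superset[of "{..n}" m] by (auto simp: monomials_def)

lemma monomials_eqI:
  assumes "a \<in> monomials n d" "b \<in> monomials n e"
    and "\<And>k. k \<le> n \<Longrightarrow> Poly_Mapping.lookup a k = Poly_Mapping.lookup b k"
  shows "a = b"
proof (rule poly_mapping_eqI)
  fix k show "Poly_Mapping.lookup a k = Poly_Mapping.lookup b k"
  proof (cases "k \<le> n")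
    case False
    then have "k \<notin> Poly_Mapping.keys a" "k \<notin> Poly_Mapping.keys b"
      using assms(1,2) by (auto simp: monomials_def)
    then show ?thesis by (simp add: in_keys_iff)
  qed (use assms in auto)
qed

lemma finite_monomials [simp]: "finite (monomials n d)"
proof (rule inj_on_finite)
  show "inj_on (\<lambda>m. \<lambda>k\<in>{..n}. Poly_Mapping.lookup m k) (monomials n d)"
  proof (rule inj_onI)
    fix a b assume ab: "a \<in> monomials n d" "b \<in> monomials n d"
      "(\<lambda>k\<in>{..n}. Poly_Mapping.lookup a k) = (\<lambda>k\<in>{..n}. Poly_Mapping.lookup b k)"
    have "Poly_Mapping.lookup a k = Poly_Mapping.lookup b k" if "k \<le> n" for k
      using fun_cong[OF ab(3), of k] that by simp
    then show "a = b" by (rule monomials_eqI[OF ab(1,2)])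
  qed
  show "(\<lambda>m. \<lambda>k\<in>{..n}. Poly_Mapping.lookup m k) ` monomials n d \<subseteq> {..n} \<rightarrow>\<^sub>E {..d}"
  proof (intro image_subsetI restrict_PiE_iff[THEN iffD2] ballI)
    fix m k assume "m \<in> monomials n d" "k \<in> {..n}"
    then show "Poly_Mapping.lookup m k \<in> {..d}"
      using member_le_sum[of k "{..n}" "Poly_Mapping.lookup m"] lookup_monomials_degree[of m n d] by auto
  qed
qed (auto intro: finite_PiE)

lemma monomials_nonempty: "monomials n d \<noteq> {}"
  using single_in_monomials[of 0 n d] by auto

lemma monomials_0: "monomials n 0 = {0}"
  by (auto simp: monomials_def mono_degree_def in_keys_iff intro!: poly_mapping_eqI)

lemma shadow_subset: "M \<subseteq> monomials n d \<Longrightarrow> shadow n M \<subseteq> monomials n (Suc d)"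
  using monomials_add[of _ n d _ 1] single_in_monomials[of _ n 1] by (fastforce simp: shadow_def)

lemma minus_var_add_var: "Poly_Mapping.lookup m k > 0 \<Longrightarrow> (m - var k) + var k = (m :: nat \<Rightarrow>\<^sub>0 nat)"
  by (rule poly_mapping_eqI) (auto simp: lookup_add lookup_minus lookup_single when_def)

lemma minus_var_in_monomials:
  assumes "m \<in> monomials n (Suc d)" "Poly_Mapping.lookup m k > 0"
  shows "m - var k \<in> monomials n d"
proof -
  have "Suc (mono_degree (m - var k)) = mono_degree m"
    using mono_degree_add[of "m - var k" "var k"] minus_var_add_var[OF assms(2)] by simp
  moreover have "Poly_Mapping.keys (m - var k) \<subseteq> Poly_Mapping.keys m"
    by (auto simp: in_keys_iff lookup_minus)
  ultimately show ?thesis using assms(1) by (auto simp: monomials_def)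
qed

lemma shadow_monomials: "shadow n (monomials n d) = monomials n (Suc d)"
proof
  show "monomials n (Suc d) \<subseteq> shadow n (monomials n d)"
  proof
    fix m assume m: "m \<in> monomials n (Suc d)"
    then obtain k where k: "k \<le> n" "Poly_Mapping.lookup m k > 0"
      using lookup_monomials_degree[OF m] by (metis (no_types, lifting) atMost_iff neq0_conv
          nat.distinct(1) sum.neutral)
    have "m = (\<lambda>(m, k). m + var k) (m - var k, k)" using minus_var_add_var[OF k(2)] by simp
    then show "m \<in> shadow n (monomials n d)"
      unfolding shadow_def using minus_var_in_monomials[OF m k(2)] k(1)
      by (metis (no_types, lifting) SigmaI atMost_iff image_eqI)
  qed
qed (rule shadow_subset[OF subset_refl])

text \<open>Double count of the pairs \<open>(m x\<^sub>k, k)\<close>, weighted by the exponent of \<open>x\<^sub>k\<close>: each \<open>m \<in> M\<close> contributes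
  \<open>d + n + 1\<close>, and each monomial of the shadow receives at most its degree \<open>d + 1\<close>.\<close>

definition shadow_pairs :: "nat \<Rightarrow> (nat \<Rightarrow>\<^sub>0 nat) set \<Rightarrow> ((nat \<Rightarrow>\<^sub>0 nat) \<times> nat) set" where
  "shadow_pairs n M = (\<lambda>(m, k). (m + var k, k)) ` (M \<times> {..n})"

text \<open>A pair \<open>(m + var k, k)\<close> determines \<open>m\<close>, so the sum can be
  reindexed. In it the exponent of each of the \<open>n + 1\<close> variables is raised by one,
  which turns the degree \<open>d\<close> into \<open>d + n + 1\<close>.\<close>

lemma shadow_pairs_weight:
  assumes "M \<subseteq> monomials n d"
  shows "(\<Sum>(m, k)\<in>shadow_pairs n M. Poly_Mapping.lookup m k) = card M * (d + n + 1)"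
proof -
  have "(\<Sum>(m, k)\<in>shadow_pairs n M. Poly_Mapping.lookup m k)
      = (\<Sum>(m, k)\<in>M \<times> {..n}. Poly_Mapping.lookup m k + 1)"
    unfolding shadow_pairs_def
    by (subst sum.reindex) (auto simp: inj_on_def lookup_add case_prod_beta)
  also have "\<dots> = (\<Sum>m\<in>M. \<Sum>k\<le>n. Poly_Mapping.lookup m k + 1)"
    by (simp only: sum.cartesian_product)
  also have "\<dots> = (\<Sum>m\<in>M. d + n + 1)"
  proof (rule sum.cong)
    fix m assume "m \<in> M"
    then have "(\<Sum>k\<le>n. Poly_Mapping.lookup m k) = d" using assms lookup_monomials_degree by blast
    then show "(\<Sum>k\<le>n. Poly_Mapping.lookup m k + 1) = d + n + 1" by (simp only: sum.distrib) simp
  qed simp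
  finally show ?thesis by simp
qed

lemma weight_monomials:
  assumes "M \<subseteq> monomials n d"
  shows "(\<Sum>(m, k)\<in>M \<times> {..n}. Poly_Mapping.lookup m k) = card M * d"
proof -
  have "(\<Sum>(m, k)\<in>M \<times> {..n}. Poly_Mapping.lookup m k) = (\<Sum>m\<in>M. \<Sum>k\<le>n. Poly_Mapping.lookup m k)"
    by (simp only: sum.cartesian_product)
  also have "\<dots> = (\<Sum>m\<in>M. d)"
    by (rule sum.cong) (use assms lookup_monomials_degree in auto)
  finally show ?thesis by simp
qed

lemma shadow_pairs_subset: "shadow_pairs n M \<subseteq> shadow n M \<times> {..n}"
  by (auto simp: shadow_pairs_def shadow_def)

lemma finite_shadow: "finite M \<Longrightarrow> finite (shadow n M)"
  by (simp add: shadow_def)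

lemma card_shadow_ge:
  assumes "M \<subseteq> monomials n d"
  shows "card M * (d + n + 1) \<le> card (shadow n M) * (d + 1)"
proof -
  have "finite (shadow n M)" using assms finite_monomials finite_subset finite_shadow by metis
  then have "(\<Sum>(m, k)\<in>shadow_pairs n M. Poly_Mapping.lookup m k)
      \<le> (\<Sum>(m, k)\<in>shadow n M \<times> {..n}. Poly_Mapping.lookup m k)"
    by (intro sum_mono2 shadow_pairs_subset) auto
  then show ?thesis
    using shadow_pairs_weight[OF assms] weight_monomials[OF shadow_subset[OF assms]] by simp
qed

text \<open>Equality in the double count: a pair \<open>(m, k)\<close> missing from
  \<open>shadow_pairs\<close> for the full level has a variable that does not divide
  \<open>m\<close>, hence weight zero. This yields the growth rate without binomial
  coefficients.\<close>

lemma card_monomials_Suc: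
  "card (monomials n d) * (d + n + 1) = card (monomials n (Suc d)) * (d + 1)"
proof -
  have "(\<Sum>(m, k)\<in>monomials n (Suc d) \<times> {..n}. Poly_Mapping.lookup m k)
      = (\<Sum>(m, k)\<in>shadow_pairs n (monomials n d). Poly_Mapping.lookup m k)"
  proof (rule sum.mono_neutral_right)
    show "shadow_pairs n (monomials n d) \<subseteq> monomials n (Suc d) \<times> {..n}"
      using shadow_pairs_subset[of n "monomials n d"] by (simp only: shadow_monomials)
    show "\<forall>i\<in>monomials n (Suc d) \<times> {..n} - shadow_pairs n (monomials n d).
        (case i of (m, k) \<Rightarrow> Poly_Mapping.lookup m k) = 0"
    proof (clarify, rule ccontr)
      fix m k assume mk: "(m, k) \<notin> shadow_pairs n (monomials n d)" "m \<in> monomials n (Suc d)" "k \<le> n"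
        and nz: "Poly_Mapping.lookup m k \<noteq> 0"
      have "(m, k) = (\<lambda>(m, k). (m + var k, k)) (m - var k, k)" using minus_var_add_var nz by simp
      moreover have "(m - var k, k) \<in> monomials n d \<times> {..n}"
        using minus_var_in_monomials mk nz by simp
      ultimately have "(m, k) \<in> shadow_pairs n (monomials n d)"
        unfolding shadow_pairs_def by (rule image_eqI)
      then show False using mk(1) by simp
    qed
  qed simp
  then show ?thesis using shadow_pairs_weight[OF subset_refl, of n d] weight_monomials[OF subset_refl, of n "Suc d"]
    by simp
qed

text \<open>Exponent vectors with equal sums are incomparable unless equal. Applied in both
  directions, this supplies the two variables of a move.\<close>

lemma exists_smaller_exponent:
  assumes "a \<in> monomials n d" "b \<in> monomials n d" "a \<noteq> b"
  shows "\<exists>k\<le>n. Poly_Mapping.lookup a k < Poly_Mapping.lookup b k"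
proof (rule ccontr)
  assume "\<not> ?thesis"
  then have le: "Poly_Mapping.lookup b k \<le> Poly_Mapping.lookup a k" if "k \<le> n" for k
    using that by (meson not_less)
  have "Poly_Mapping.lookup b k = Poly_Mapping.lookup a k" if "k \<le> n" for k
  proof (rule ccontr)
    assume "Poly_Mapping.lookup b k \<noteq> Poly_Mapping.lookup a k"
    then have "(\<Sum>k\<le>n. Poly_Mapping.lookup b k) < (\<Sum>k\<le>n. Poly_Mapping.lookup a k)"
      using le that by (intro sum_strict_mono_ex1) (auto intro!: bexI[of _ k] le_neq_trans)
    then show False using lookup_monomials_degree[OF assms(1)] lookup_monomials_degree[OF assms(2)] by simp
  qed
  then show False using monomials_eqI[OF assms(1,2)] assms(3) by simp
qed

text \<open>Any two monomials of the same degree are joined by a chain of moves that replace one variable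
  by another, so such a move leaves every proper nonempty set of monomials somewhere.\<close>

lemma exists_boundary_move:
  assumes u: "u \<in> monomials n d" "u \<notin> M" and M: "M \<subseteq> monomials n d" and m: "m \<in> M"
  shows "\<exists>m\<in>M. \<exists>m'\<in>monomials n d - M. \<exists>k\<le>n. \<exists>l\<le>n. m + var k = m' + var l"
  using m
\<comment> \<open>Truncated subtraction makes the measure the sum of the exponents that
  \<open>m\<close> still lacks compared with \<open>u\<close>.\<close>
proof (induction "\<Sum>k\<le>n. Poly_Mapping.lookup u k - Poly_Mapping.lookup m k" arbitrary: m rule: less_induct)
  case less
  have mM: "m \<in> monomials n d" using less.prems M by blast
  have "m \<noteq> u" using u less.prems by blast
  then obtain k l where k: "k \<le> n" "Poly_Mapping.lookup m k < Poly_Mapping.lookup u k"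
    and l: "l \<le> n" "Poly_Mapping.lookup u l < Poly_Mapping.lookup m l"
    using exists_smaller_exponent[OF mM u(1)] exists_smaller_exponent[OF u(1) mM] by metis
  define m' where "m' = m + var k - var l"
  have pos: "Poly_Mapping.lookup (m + var k) l > 0" using l by (simp add: lookup_add)
  have "m + var k \<in> monomials n (Suc d)"
    using monomials_add[OF mM single_in_monomials[OF k(1), of 1]] by simp
  then have m': "m' \<in> monomials n d" unfolding m'_def using pos by (rule minus_var_in_monomials)
  have eq: "m + var k = m' + var l" unfolding m'_def using minus_var_add_var[OF pos] by simp
  show ?case
  proof (cases "m' \<in> M")
    case True
    have lookup: "Poly_Mapping.lookup m' i = Poly_Mapping.lookup m i + (if i = k then 1 else 0) - (if i = l then 1 else 0)" for i
      by (auto simp: m'_def lookup_add lookup_minus lookup_single when_def)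
    have "k \<noteq> l" using k l by auto
    \<comment> \<open>The move lowers the deficit at \<open>k\<close> and creates none at
      \<open>l\<close>, where \<open>m\<close> had an excess over \<open>u\<close>.\<close>
    then have "(\<Sum>k\<le>n. Poly_Mapping.lookup u k - Poly_Mapping.lookup m' k)
        < (\<Sum>k\<le>n. Poly_Mapping.lookup u k - Poly_Mapping.lookup m k)"
      using k l by (intro sum_strict_mono_ex1) (auto simp: lookup intro!: bexI[of _ k])
    then show ?thesis using less.hyps True by blast
  next
    case False
    then show ?thesis using less.prems m' eq k(1) l(1) by blast
  qed
qed

text \<open>A boundary move \<open>m + var k = m' + var l\<close> with \<open>m'\<close> outside
  \<open>M\<close> gives the pair \<open>(m + var k, l)\<close>: it lies over the shadow and has
  positive weight, but is missing from \<open>shadow_pairs n M\<close>.\<close>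

lemma card_shadow_greater:
  assumes M: "M \<subseteq> monomials n d" "M \<noteq> {}" "M \<noteq> monomials n d"
  shows "card M * (d + n + 1) < card (shadow n M) * (d + 1)"
proof -
  obtain u m0 where "u \<in> monomials n d" "u \<notin> M" "m0 \<in> M" using M by blast
  then obtain m m' k l where m: "m \<in> M" "m' \<in> monomials n d" "m' \<notin> M" "k \<le> n" "l \<le> n"
    "m + var k = m' + var l"
    using exists_boundary_move[OF _ _ M(1)] by (metis DiffE)
  have "finite (shadow n M)" using M(1) finite_monomials finite_subset finite_shadow by metis
  moreover have "(m + var k, l) \<in> shadow n M \<times> {..n} - shadow_pairs n M"
  proof -
    have "(m + var k, l) \<notin> shadow_pairs n M" using m(3) unfolding m(6) by (auto simp: shadow_pairs_def)
    moreover have "m + var k \<in> shadow n M" using m(1,4) by (auto simp: shadow_def)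
    ultimately show ?thesis using m(5) by simp
  qed
  moreover have "Poly_Mapping.lookup (m + var k) l > 0" unfolding m(6) by (simp add: lookup_add)
  ultimately have "(\<Sum>(m, k)\<in>shadow_pairs n M. Poly_Mapping.lookup m k)
      < (\<Sum>(m, k)\<in>shadow n M \<times> {..n}. Poly_Mapping.lookup m k)"
    by (intro sum_strict_mono2[where b = "(m + var k, l)"] shadow_pairs_subset) auto
  then show ?thesis
    using shadow_pairs_weight[OF M(1)] weight_monomials[OF shadow_subset[OF M(1)]] by simp
qed

text \<open>The form in which multiples arise from products of polynomials;
  \<open>upper_shadow_Suc\<close> identifies it with the iterated shadow, to which the one-step
  estimates apply.\<close>

definition upper_shadow :: "nat \<Rightarrow> (nat \<Rightarrow>\<^sub>0 nat) set \<Rightarrow> nat \<Rightarrow> (nat \<Rightarrow>\<^sub>0 nat) set" where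
  "upper_shadow n M e = (\<lambda>(a, b). a + b) ` (M \<times> monomials n e)"

lemma upper_shadow_0: "upper_shadow n M 0 = M"
  by (force simp: upper_shadow_def monomials_0)

lemma upper_shadow_Suc: "upper_shadow n M (Suc e) = shadow n (upper_shadow n M e)"
proof -
  have "shadow n (upper_shadow n M e) = (\<lambda>(a, b). a + b) ` (M \<times> shadow n (monomials n e))"
    by (force simp: upper_shadow_def shadow_def add.assoc image_iff)
  then show ?thesis by (simp add: upper_shadow_def shadow_monomials)
qed

lemma upper_shadow_subset: "M \<subseteq> monomials n d \<Longrightarrow> upper_shadow n M e \<subseteq> monomials n (d + e)"
  by (auto simp: upper_shadow_def intro!: monomials_add)

lemma upper_shadow_monomials: "upper_shadow n (monomials n d) e = monomials n (d + e)"
  by (induction e) (simp_all add: upper_shadow_0 upper_shadow_Suc shadow_monomials)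

section \<open>Densities of iterated shadows\<close>

lemma card_monomials_pos: "card (monomials n d) > 0"
  by (simp add: card_gt_0_iff monomials_nonempty)

text \<open>The normalized matching property of the monomial poset.\<close>

lemma shadow_density:
  assumes "M \<subseteq> monomials n d"
  shows "real (card M) / card (monomials n d) \<le> card (shadow n M) / card (monomials n (Suc d))"
    and "M \<noteq> {} \<Longrightarrow> M \<noteq> monomials n d \<Longrightarrow>
      real (card M) / card (monomials n d) < card (shadow n M) / card (monomials n (Suc d))"
proof -
  let ?N = "card (monomials n d)" and ?N' = "card (monomials n (Suc d))" and ?S = "card (shadow n M)"
  have pos: "?N > 0" "?N' > 0" by (rule card_monomials_pos)+
  \<comment> \<open>The exact growth of the full level trades \<open>?N'\<close> for
    \<open>d + n + 1\<close>, after which the bounds on the shadow apply and the factor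
    \<open>d + 1\<close> cancels.\<close>
  have eq: "card M * ?N' * (d + 1) = card M * (d + n + 1) * ?N"
    using card_monomials_Suc[of n d] by (metis mult.assoc mult.commute)
  have "card M * ?N' * (d + 1) \<le> ?S * ?N * (d + 1)"
    unfolding eq using mult_right_mono[OF card_shadow_ge[OF assms], of ?N] by (simp add: algebra_simps)
  then have "card M * ?N' \<le> ?S * ?N" by (simp only: mult_le_cancel2)
  then show "real (card M) / ?N \<le> ?S / ?N'"
    using pos by (simp add: divide_simps mult.commute flip: of_nat_mult)
  assume "M \<noteq> {}" "M \<noteq> monomials n d"
  then have "card M * ?N' * (d + 1) < ?S * ?N * (d + 1)"
    unfolding eq using mult_strict_right_mono[OF card_shadow_greater[OF assms], of ?N] pos
    by (simp add: algebra_simps)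
  then have "card M * ?N' < ?S * ?N" by (simp only: mult_less_cancel2)
  then show "real (card M) / ?N < ?S / ?N'"
    using pos by (simp add: divide_simps mult.commute flip: of_nat_mult)
qed

text \<open>Strictness is gained in the first step only: a later shadow may already be a full level,
  where just the weak inequality holds. Hence the shift to \<open>Suc e\<close>.\<close>

lemma upper_shadow_density:
  assumes "M \<subseteq> monomials n d" "M \<noteq> {}" "M \<noteq> monomials n d"
  shows "real (card M) / card (monomials n d)
    < card (upper_shadow n M (Suc e)) / card (monomials n (d + Suc e))"
proof (induction e)
  case 0
  then show ?case using shadow_density(2)[OF assms] by (simp add: upper_shadow_Suc upper_shadow_0)
next
  case (Suc e)
  also have "card (upper_shadow n M (Suc e)) / card (monomials n (d + Suc e))
      \<le> card (upper_shadow n M (Suc (Suc e))) / card (monomials n (d + Suc (Suc e)))"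
    using shadow_density(1)[OF upper_shadow_subset[OF assms(1), of "Suc e"]]
    by (simp add: upper_shadow_Suc)
  finally show ?case .
qed

section \<open>Dimensions of spaces of sections\<close>

text \<open>\<open>Max\<close> refers to the lexicographic linear order carried by poly mappings.
  The zero polynomial has no leading monomial, hence its exclusion in
  \<open>leading_monomials\<close>.\<close>

definition leading :: "mpoly \<Rightarrow> (nat \<Rightarrow>\<^sub>0 nat)" where
  "leading p = Max (Poly_Mapping.keys p)"

definition leading_monomials :: "mpoly set \<Rightarrow> (nat \<Rightarrow>\<^sub>0 nat) set" where
  "leading_monomials K = leading ` (K - {0})"

definition poly_space :: "mpoly set \<Rightarrow> bool" where
  "poly_space K \<longleftrightarrow> 0 \<in> K \<and> (\<forall>p\<in>K. \<forall>q\<in>K. p + q \<in> K) \<and> (\<forall>c. \<forall>p\<in>K. Poly_Mapping.single 0 c * p \<in> K)"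

lemma leading_in_keys: "p \<noteq> 0 \<Longrightarrow> leading p \<in> Poly_Mapping.keys p"
  unfolding leading_def by (rule Max_in) auto

lemma lookup_above_leading: "leading p < m \<Longrightarrow> Poly_Mapping.lookup p m = 0"
  unfolding leading_def by (metis Max_ge finite_keys in_keys_iff leD)

lemma leading_eqI:
  assumes "m \<in> Poly_Mapping.keys p" "\<And>m'. m' \<in> Poly_Mapping.keys p \<Longrightarrow> m' \<le> m"
  shows "leading p = m"
  unfolding leading_def by (rule Max_eqI) (use assms in auto)

lemma lookup_const_mult:
  fixes p :: mpoly
  shows "Poly_Mapping.lookup (Poly_Mapping.single 0 c * p) m = c * Poly_Mapping.lookup p m"
  by (simp add: Poly_Mapping.map.rep_eq when_def flip: mult_map_scale_conv_mult)

lemma lookup_mult_single: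
  fixes p :: mpoly
  shows "Poly_Mapping.lookup (p * Poly_Mapping.single u 1) (m + u) = Poly_Mapping.lookup p m"
proof -
  have "p * Poly_Mapping.single u 1
      = (\<Sum>a\<in>Poly_Mapping.keys p. Poly_Mapping.single (a + u) (Poly_Mapping.lookup p a))"
    by (subst mpoly_sum_singles[of p]) (simp add: sum_distrib_right mult_single)
  then show ?thesis
    by (simp add: lookup_sum lookup_single when_def in_keys_iff)
qed

text \<open>The order is compatible with addition of exponents, and multiplying by a monomial only
  translates the support, so nothing cancels at the top.\<close>

lemma leading_mult_single:
  fixes p :: mpoly
  assumes "p \<noteq> 0"
  shows "p * Poly_Mapping.single u 1 \<noteq> 0" "leading (p * Poly_Mapping.single u 1) = leading p + u"
proof -
  have in_keys: "leading p + u \<in> Poly_Mapping.keys (p * Poly_Mapping.single u 1)"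
    using leading_in_keys[OF assms] by (simp add: in_keys_iff lookup_mult_single)
  then show "p * Poly_Mapping.single u 1 \<noteq> 0" by auto
  show "leading (p * Poly_Mapping.single u 1) = leading p + u"
  proof (rule leading_eqI[OF in_keys])
    fix m assume "m \<in> Poly_Mapping.keys (p * Poly_Mapping.single u 1)"
    then obtain a where "a \<in> Poly_Mapping.keys p" "m = a + u"
      using keys_mult[of p "Poly_Mapping.single u 1"] by (auto split: if_splits)
    then show "m \<le> leading p + u" by (simp add: leading_def add_right_mono)
  qed
qed

lemma leading_monomials_subset: "K \<subseteq> {p. homogeneous n d p} \<Longrightarrow> leading_monomials K \<subseteq> monomials n d"
  using leading_in_keys by (fastforce simp: leading_monomials_def homogeneous_iff)

text \<open>Reduction: subtracting a multiple of an element of \<open>V\<close> cancels the leading term.\<close>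

lemma poly_space_eqI:
  assumes V: "poly_space V" and K: "poly_space K" and "V \<subseteq> K"
    and hom: "K \<subseteq> {p. homogeneous n d p}" and lead: "leading_monomials K \<subseteq> leading_monomials V"
  shows "K \<subseteq> V"
proof
  fix p assume "p \<in> K"
  then show "p \<in> V"
  \<comment> \<open>With infinitely many variables the lexicographic order is not well-founded;
    inside the finite set \<open>monomials n d\<close> a count serves as measure.\<close>
  proof (induction "card {m \<in> monomials n d. m \<le> leading p}" arbitrary: p rule: less_induct)
    case less
    show ?case
    proof (cases "p = 0")
      case True
      then show ?thesis using V by (simp add: poly_space_def)
    next
      case False
      define m where "m = leading p"
      have "m \<in> leading_monomials V" using lead less.prems False by (auto simp: leading_monomials_def m_def)
      then obtain q where q: "q \<in> V" "q \<noteq> 0" "leading q = m" by (auto simp: leading_monomials_def)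
      define c where "c = Poly_Mapping.lookup p m / Poly_Mapping.lookup q m"
      define r where "r = p + Poly_Mapping.single 0 (- c) * q"
      have lr: "Poly_Mapping.lookup r k = Poly_Mapping.lookup p k - c * Poly_Mapping.lookup q k" for k
        by (simp add: r_def lookup_add lookup_const_mult)
      have rK: "r \<in> K" unfolding r_def using K less.prems q(1) \<open>V \<subseteq> K\<close> by (auto simp: poly_space_def)
      have p: "p = r + Poly_Mapping.single 0 c * q"
        by (rule poly_mapping_eqI) (simp add: lookup_add lr lookup_const_mult)
      have "r \<in> V"
      proof (cases "r = 0")
        case True
        then show ?thesis using V by (simp add: poly_space_def)
      next
        case rnz: False
        have "Poly_Mapping.lookup q m \<noteq> 0" using leading_in_keys[OF q(2)] q(3) by (simp add: in_keys_iff)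
        then have "Poly_Mapping.lookup r m = 0" by (simp add: lr c_def)
        moreover have "Poly_Mapping.lookup r k = 0" if "m < k" for k
          using that lookup_above_leading[of p k] lookup_above_leading[of q k] q(3) by (simp add: lr m_def)
        ultimately have "leading r < m"
          using leading_in_keys[OF rnz] by (metis in_keys_iff linorder_neqE)
        have "m \<in> monomials n d"
          using leading_monomials_subset[OF hom] less.prems False by (auto simp: leading_monomials_def m_def)
        then have "m \<in> {a \<in> monomials n d. a \<le> leading p} - {a \<in> monomials n d. a \<le> leading r}"
          using \<open>leading r < m\<close> by (simp add: m_def)
        moreover have "{a \<in> monomials n d. a \<le> leading r} \<subseteq> {a \<in> monomials n d. a \<le> leading p}"
          using \<open>leading r < m\<close> unfolding m_def by (auto dest: order_trans[OF _ less_imp_le])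
        ultimately have "card {a \<in> monomials n d. a \<le> leading r} < card {a \<in> monomials n d. a \<le> leading p}"
          by (intro psubset_card_mono psubsetI) auto
        then show ?thesis using less.hyps rK by blast
      qed
      then show ?thesis using V q(1) p by (simp add: poly_space_def)
    qed
  qed
qed

section \<open>Forms as global sections\<close>

definition poly_section :: "nat \<Rightarrow> mpoly \<Rightarrow> vec \<Rightarrow> complex" where
  "poly_section n p = (\<lambda>x\<in>punctured_space n. mpoly_eval p x)"

lemma poly_section_inj:
  assumes "homogeneous n d p" "homogeneous n d q" "poly_section n p = poly_section n q"
  shows "p = q"
proof (rule homogeneous_eqI[OF assms(1,2)])
  fix x assume "x \<in> punctured_space n"
  then show "mpoly_eval p x = mpoly_eval q x"
    using fun_cong[OF assms(3), of x] by (simp add: poly_section_def)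
qed

lemma poly_section_0: "poly_section n 0 = (\<lambda>x\<in>punctured_space n. 0)"
  by (simp add: poly_section_def)

lemma H0_twist_simps [simp]:
  "carrier (H0 n (twist n d)) = twist_sections n d (proj_space n)"
  "\<zero>\<^bsub>H0 n (twist n d)\<^esub> = (\<lambda>x\<in>punctured_space n. 0)"
  "f \<oplus>\<^bsub>H0 n (twist n d)\<^esub> g = (\<lambda>x\<in>punctured_space n. f x + g x)"
  "c \<odot>\<^bsub>H0 n (twist n d)\<^esub> f = (\<lambda>x\<in>punctured_space n. c * f x)"
  by (simp_all add: H0_def Union_proj_space cong: restrict_cong)

lemma poly_section_in_H0:
  "homogeneous n d p \<Longrightarrow> poly_section n p \<in> twist_sections n (int d) (proj_space n)"
  unfolding poly_section_def
  using twist_sections_homogeneous[OF zariski_open_proj_space, of n d p] by (simp add: Union_proj_space)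

lemma H0_poly_section:
  assumes "n \<ge> 1" "f \<in> twist_sections n (int d) (proj_space n)"
  obtains p where "homogeneous n d p" "f = poly_section n p"
proof -
  obtain p where p: "homogeneous n d p" "\<And>x. x \<in> punctured_space n \<Longrightarrow> f x = mpoly_eval p x"
    using global_section_homogeneous[OF assms] by blast
  have "f = poly_section n p"
    using twist_sections_extensional[OF assms(2)] p(2)
    by (intro extensionalityI[where A = "punctured_space n"]) (auto simp: poly_section_def Union_proj_space)
  then show ?thesis using that p(1) by blast
qed

lemma field_complex_field: "field complex_field"
proof -
  interpret cring complex_field
    by (rule cringI, rule abelian_groupI, auto simp: complex_field_def algebra_simps
        intro!: comm_monoidI) (metis add.right_inverse)
  have "Units complex_field = carrier complex_field - {\<zero>\<^bsub>complex_field\<^esub>}"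
    by (auto simp: complex_field_def Units_def) (metis left_inverse right_inverse)
  then show ?thesis by (rule cring_fieldI)
qed

lemma vectorspace_H0: "vectorspace complex_field (H0 n (twist n (int d)))"
proof -
  have *: "(\<lambda>x\<in>punctured_space n. f x + g x) \<in> twist_sections n (int d) (proj_space n)"
    "(\<lambda>x\<in>punctured_space n. c * f x) \<in> twist_sections n (int d) (proj_space n)"
    if "f \<in> twist_sections n (int d) (proj_space n)" "g \<in> twist_sections n (int d) (proj_space n)" for f g c
    using twist_sections_add[OF that] twist_sections_scalar[OF zariski_open_proj_space that(1), of c]
    by (simp_all add: Union_proj_space)
  have ext: "f \<in> extensional (punctured_space n)" if "f \<in> twist_sections n (int d) (proj_space n)" for f
    using twist_sections_extensional[OF that] by (simp add: Union_proj_space)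
  have neg: "\<exists>g\<in>twist_sections n (int d) (proj_space n).
      (\<lambda>x\<in>punctured_space n. f x + g x) = (\<lambda>x\<in>punctured_space n. 0)"
    if "f \<in> twist_sections n (int d) (proj_space n)" for f
    using *(2)[OF that that, of "-1"]
    by (intro bexI[of _ "\<lambda>x\<in>punctured_space n. - 1 * f x"]) (auto cong: restrict_cong)
  show ?thesis
    by (rule vs_criteria[OF field_complex_field])
      (use poly_section_in_H0[OF homogeneous_0] in \<open>auto simp: * neg complex_field_def poly_section_0 ext
        extensional_restrict algebra_simps cong: restrict_cong\<close>)
qed

text \<open>Subspaces of sections are pulled back to forms, where leading monomials make
  sense.\<close>

definition polys_of :: "nat \<Rightarrow> nat \<Rightarrow> (vec \<Rightarrow> complex) set \<Rightarrow> mpoly set" where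
  "polys_of n d V = {p. homogeneous n d p \<and> poly_section n p \<in> V}"

lemma subspace_H0I:
  assumes "V \<subseteq> twist_sections n (int d) (proj_space n)" "(\<lambda>x\<in>punctured_space n. 0) \<in> V"
    and "\<And>f g. f \<in> V \<Longrightarrow> g \<in> V \<Longrightarrow> (\<lambda>x\<in>punctured_space n. f x + g x) \<in> V"
    and "\<And>c f. f \<in> V \<Longrightarrow> (\<lambda>x\<in>punctured_space n. c * f x) \<in> V"
  shows "VectorSpace.subspace complex_field V (H0 n (twist n (int d)))"
proof -
  interpret vectorspace complex_field "H0 n (twist n (int d))" by (rule vectorspace_H0)
  show ?thesis
    by (intro subspace.intro vectorspace_H0 LinearCombinations.submodule.intro module_axioms)
      (use assms in auto)
qed

lemma subspace_H0D:
  assumes "VectorSpace.subspace complex_field V (H0 n (twist n (int d)))"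
  shows "V \<subseteq> twist_sections n (int d) (proj_space n)" "(\<lambda>x\<in>punctured_space n. 0) \<in> V"
    and "f \<in> V \<Longrightarrow> g \<in> V \<Longrightarrow> (\<lambda>x\<in>punctured_space n. f x + g x) \<in> V"
    and "f \<in> V \<Longrightarrow> (\<lambda>x\<in>punctured_space n. c * f x) \<in> V"
proof -
  have sub: "LinearCombinations.submodule complex_field V (H0 n (twist n (int d)))"
    using assms by (simp add: VectorSpace.subspace_def)
  show "V \<subseteq> twist_sections n (int d) (proj_space n)" "(\<lambda>x\<in>punctured_space n. 0) \<in> V"
    using LinearCombinations.submodule.subset[OF sub] LinearCombinations.submodule.zero_closed[OF sub]
    by simp_all
  show "f \<in> V \<Longrightarrow> g \<in> V \<Longrightarrow> (\<lambda>x\<in>punctured_space n. f x + g x) \<in> V"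
    using LinearCombinations.submodule.m_closed[OF sub, of f g] by simp
  show "f \<in> V \<Longrightarrow> (\<lambda>x\<in>punctured_space n. c * f x) \<in> V"
    using LinearCombinations.submodule.smult_closed[OF sub, of c f] by (simp add: complex_field_def)
qed

lemma poly_section_add:
  "poly_section n (p + q) = (\<lambda>x\<in>punctured_space n. poly_section n p x + poly_section n q x)"
  by (auto simp: poly_section_def mpoly_eval_add)

lemma poly_section_scalar:
  "poly_section n (Poly_Mapping.single 0 c * p) = (\<lambda>x\<in>punctured_space n. c * poly_section n p x)"
  by (auto simp: poly_section_def mpoly_eval_mult)

lemma poly_space_polys_of:
  assumes "VectorSpace.subspace complex_field V (H0 n (twist n (int d)))"
  shows "poly_space (polys_of n d V)"
  using subspace_H0D[OF assms] unfolding poly_space_def polys_of_def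
  by (simp add: poly_section_0 poly_section_add poly_section_scalar homogeneous_add homogeneous_const_mult)

lemma polys_of_homogeneous: "polys_of n d V \<subseteq> {p. homogeneous n d p}"
  by (auto simp: polys_of_def)

lemma polys_of_section:
  assumes "n \<ge> 1" "V \<subseteq> twist_sections n (int d) (proj_space n)" "f \<in> V"
  obtains p where "p \<in> polys_of n d V" "f = poly_section n p"
proof -
  obtain p where "homogeneous n d p" "f = poly_section n p"
    using H0_poly_section[OF assms(1)] assms(2,3) by blast
  then show ?thesis using that assms(3) by (simp add: polys_of_def)
qed

lemma leading_monomials_H0:
  "leading_monomials (polys_of n d (twist_sections n (int d) (proj_space n))) = monomials n d"
proof
  show "monomials n d \<subseteq> leading_monomials (polys_of n d (twist_sections n (int d) (proj_space n)))"
  proof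
    fix m assume "m \<in> monomials n d"
    then have "homogeneous n d (Poly_Mapping.single m 1)" by (rule homogeneous_single)
    moreover have "leading (Poly_Mapping.single m 1) = m" by (rule leading_eqI) auto
    moreover have "Poly_Mapping.single m 1 \<noteq> (0 :: mpoly)" by (metis lookup_single_eq lookup_zero zero_neq_one)
    ultimately show "m \<in> leading_monomials (polys_of n d (twist_sections n (int d) (proj_space n)))"
      unfolding leading_monomials_def
      by (intro image_eqI[of _ _ "Poly_Mapping.single m 1"]) (auto simp: polys_of_def poly_section_in_H0)
  qed
qed (rule leading_monomials_subset[OF polys_of_homogeneous])

text \<open>Turns an inclusion of subspaces into an equality without comparing dimensions. It serves
  three times: for the spanning half of the dimension formula, for surjectivity of
  \<open>ev\<close>, and to see that a proper subspace misses a leading monomial.\<close>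

lemma subspace_mono_leading:
  assumes n: "n \<ge> 1"
    and V: "VectorSpace.subspace complex_field V (H0 n (twist n (int d)))"
    and W: "VectorSpace.subspace complex_field W (H0 n (twist n (int d)))"
    and "V \<subseteq> W" and "leading_monomials (polys_of n d W) \<subseteq> leading_monomials (polys_of n d V)"
  shows "W \<subseteq> V"
proof
  fix f assume "f \<in> W"
  then obtain p where p: "p \<in> polys_of n d W" "f = poly_section n p"
    using polys_of_section[OF n subspace_H0D(1)[OF W]] by blast
  have "polys_of n d V \<subseteq> polys_of n d W" using \<open>V \<subseteq> W\<close> by (auto simp: polys_of_def)
  then have "polys_of n d W \<subseteq> polys_of n d V"
    using poly_space_eqI[OF poly_space_polys_of[OF V] poly_space_polys_of[OF W] _ polys_of_homogeneous] assms(5)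
    by blast
  then show "f \<in> V" using p by (auto simp: polys_of_def)
qed

lemma subspace_H0_carrier:
  "VectorSpace.subspace complex_field (twist_sections n (int d) (proj_space n)) (H0 n (twist n (int d)))"
proof (rule subspace_H0I)
  show "(\<lambda>x\<in>punctured_space n. 0) \<in> twist_sections n (int d) (proj_space n)"
    using poly_section_in_H0[OF homogeneous_0] by (simp add: poly_section_0)
next
  fix f g assume "f \<in> twist_sections n (int d) (proj_space n)" "g \<in> twist_sections n (int d) (proj_space n)"
  then show "(\<lambda>x\<in>punctured_space n. f x + g x) \<in> twist_sections n (int d) (proj_space n)"
    using twist_sections_add[of f n "int d" "proj_space n" g] by (simp add: Union_proj_space)
next
  fix c f assume "f \<in> twist_sections n (int d) (proj_space n)"
  then show "(\<lambda>x\<in>punctured_space n. c * f x) \<in> twist_sections n (int d) (proj_space n)"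
    using twist_sections_scalar[OF zariski_open_proj_space, of f n "int d" c] by (simp add: Union_proj_space)
qed simp

text \<open>Choosing one element for each leading monomial gives a basis: distinct leading monomials
  force independence, and the span already has all leading monomials of \<open>V\<close>, hence
  equals \<open>V\<close>.\<close>

lemma dim_in_H0_eq:
  assumes n: "n \<ge> 1" and sub: "VectorSpace.subspace complex_field V (H0 n (twist n (int d)))"
  shows "dim_in_H0 n (twist n (int d)) V = card (leading_monomials (polys_of n d V))"
proof -
  let ?H = "H0 n (twist n (int d))" and ?X = "punctured_space n"
  let ?L = "leading_monomials (polys_of n d V)"
  note V = subspace_H0D[OF sub]
  interpret H: vectorspace complex_field ?H by (rule vectorspace_H0)
  interpret vectorspace complex_field "?H\<lparr>carrier := V\<rparr>" by (rule H.subspace_is_vs[OF sub])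
  have K: "carrier complex_field = UNIV" "\<zero>\<^bsub>complex_field\<^esub> = 0" by (simp_all add: complex_field_def)
  have ops: "\<zero>\<^bsub>?H\<lparr>carrier := V\<rparr>\<^esub> = (\<lambda>x\<in>?X. 0)"
    "f \<oplus>\<^bsub>?H\<lparr>carrier := V\<rparr>\<^esub> g = (\<lambda>x\<in>?X. f x + g x)"
    "c \<odot>\<^bsub>?H\<lparr>carrier := V\<rparr>\<^esub> f = (\<lambda>x\<in>?X. c * f x)" for f g c
    using H0_twist_simps[of n "int d"] by simp_all
  have lincomb: "lincomb a A = (\<lambda>x\<in>?X. \<Sum>v\<in>A. a v * v x)" if "finite A" "A \<subseteq> V" for a A
    using that
  proof (induction A)
    case empty
    then show ?case by (simp add: lincomb_def ops)
  next
    case (insert v A)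
    have "lincomb a (insert v A) = (a v \<odot>\<^bsub>?H\<lparr>carrier := V\<rparr>\<^esub> v) \<oplus>\<^bsub>?H\<lparr>carrier := V\<rparr>\<^esub> lincomb a A"
      unfolding lincomb_def
      by (rule finsum_insert) (use insert in \<open>auto simp: K intro!: V(4)\<close>)
    also have "\<dots> = (\<lambda>x\<in>?X. \<Sum>v\<in>insert v A. a v * v x)"
      unfolding ops insert.IH[OF insert.prems[THEN insert_subset[THEN iffD1, THEN conjunct2]]]
      using insert.hyps by (auto intro!: restrict_ext)
    finally show ?case .
  qed
  have LM: "?L \<subseteq> monomials n d" by (rule leading_monomials_subset[OF polys_of_homogeneous])
  then have finL: "finite ?L" using finite_monomials finite_subset by blast
  have "\<forall>m\<in>?L. \<exists>p. p \<in> polys_of n d V \<and> p \<noteq> 0 \<and> leading p = m"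
    by (auto simp: leading_monomials_def)
  then obtain b where b: "\<And>m. m \<in> ?L \<Longrightarrow> b m \<in> polys_of n d V \<and> b m \<noteq> 0 \<and> leading (b m) = m"
    unfolding bchoice_iff by blast
  define s where "s m = poly_section n (b m)" for m
  have sV: "s m \<in> V" if "m \<in> ?L" for m using b[OF that] by (simp add: s_def polys_of_def)
  have inj: "inj_on s ?L"
  proof (rule inj_onI)
    fix m m' assume "m \<in> ?L" "m' \<in> ?L" "s m = s m'"
    then have "b m = b m'" using b poly_section_inj[of n d] by (auto simp: s_def polys_of_def)
    then show "m = m'" using b \<open>m \<in> ?L\<close> \<open>m' \<in> ?L\<close> by metis
  qed
  define A where "A = s ` ?L"
  have A: "finite A" "A \<subseteq> V" using finL sV by (auto simp: A_def)
  have "lin_indpt A"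
  proof (rule finite_lin_indpt2)
    fix a assume "lincomb a A = \<zero>\<^bsub>?H\<lparr>carrier := V\<rparr>\<^esub>"
    then have zero: "(\<lambda>x\<in>?X. \<Sum>v\<in>A. a v * v x) = (\<lambda>x\<in>?X. 0)" using lincomb[OF A] ops(1) by simp
    define q where "q = (\<Sum>m\<in>?L. Poly_Mapping.single 0 (a (s m)) * b m)"
    have "homogeneous n d q"
      unfolding q_def using b by (intro homogeneous_sum homogeneous_const_mult) (auto simp: polys_of_def)
    moreover have "poly_section n q = poly_section n 0"
    proof -
      have "mpoly_eval q x = (\<Sum>v\<in>A. a v * v x)" if "x \<in> ?X" for x
      proof -
        have "s m x = mpoly_eval (b m) x" for m using that by (simp add: s_def poly_section_def)
        then show ?thesis by (simp add: q_def A_def mpoly_eval_sum mpoly_eval_mult sum.reindex[OF inj])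
      qed
      then show ?thesis unfolding poly_section_0 zero[symmetric] by (auto simp: poly_section_def intro!: restrict_ext)
    qed
    ultimately have q0: "q = 0" using poly_section_inj[OF _ homogeneous_0] by blast
    have "a (s m) = 0" if "m \<in> ?L" for m
    proof (rule ccontr)
      assume "a (s m) \<noteq> 0"
      define T where "T = {m \<in> ?L. a (s m) \<noteq> 0}"
      have T: "finite T" "T \<noteq> {}" using finL that \<open>a (s m) \<noteq> 0\<close> by (auto simp: T_def)
      \<comment> \<open>The largest leading monomial with nonzero coefficient occurs in one summand
        of \<open>q\<close> only: a smaller \<open>m\<close> cannot reach it, and a larger one has
        coefficient zero.\<close>
      define t where "t = Max T"
      have t: "t \<in> ?L" "a (s t) \<noteq> 0" using Max_in[OF T] by (auto simp: t_def T_def)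
      have "a (s m) * Poly_Mapping.lookup (b m) t = (if m = t then a (s t) * Poly_Mapping.lookup (b t) t else 0)"
        if "m \<in> ?L" for m
      proof (cases m t rule: linorder_cases)
        case less
        then show ?thesis using lookup_above_leading[of "b m" t] b[OF that] by simp
      next
        case greater
        then have "m \<notin> T" using Max_ge[OF T(1), of m] by (auto simp: t_def)
        then show ?thesis using greater that by (simp add: T_def)
      qed simp
      then have "Poly_Mapping.lookup q t = (\<Sum>m\<in>?L. if m = t then a (s t) * Poly_Mapping.lookup (b t) t else 0)"
        by (simp add: q_def lookup_sum lookup_const_mult)
      also have "\<dots> = a (s t) * Poly_Mapping.lookup (b t) t" using finL t(1) by (simp add: sum.delta)
      finally show False using q0 t leading_in_keys[of "b t"] b[OF t(1)] by (simp add: in_keys_iff)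
    qed
    then show "\<forall>v\<in>A. a v = \<zero>\<^bsub>complex_field\<^esub>" by (auto simp: A_def K)
  qed (use A in auto)
  moreover have "gen_set A"
  proof -
    have span: "VectorSpace.subspace complex_field (span A) (?H\<lparr>carrier := V\<rparr>)"
      using A by (intro span_is_subspace) simp
    then have S: "LinearCombinations.submodule complex_field (span A) (?H\<lparr>carrier := V\<rparr>)"
      by (simp add: VectorSpace.subspace_def)
    have spanV: "span A \<subseteq> V" using LinearCombinations.submodule.subset[OF S] by simp
    have subspan: "VectorSpace.subspace complex_field (span A) ?H"
    proof (rule subspace_H0I)
      show "span A \<subseteq> twist_sections n (int d) (proj_space n)" using spanV V(1) by blast
      show "(\<lambda>x\<in>?X. 0) \<in> span A" using LinearCombinations.submodule.zero_closed[OF S] by (simp only: ops)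
      show "(\<lambda>x\<in>?X. f x + g x) \<in> span A" if "f \<in> span A" "g \<in> span A" for f g
        using LinearCombinations.submodule.m_closed[OF S that] by (simp only: ops)
      show "(\<lambda>x\<in>?X. c * f x) \<in> span A" if "f \<in> span A" for c f
        using LinearCombinations.submodule.smult_closed[OF S _ that, of c] by (simp add: ops K)
    qed
    have "A \<subseteq> span A" using A by (intro in_own_span) simp
    then have "b m \<in> polys_of n d (span A)" if "m \<in> ?L" for m
      using b[OF that] that by (auto simp: polys_of_def A_def s_def)
    then have "?L \<subseteq> leading_monomials (polys_of n d (span A))"
      using b unfolding leading_monomials_def[of "polys_of n d (span A)"]
      by (intro subsetI image_eqI[where x = "b _"]) auto
    then have "V \<subseteq> span A" by (rule subspace_mono_leading[OF n subspan sub spanV])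
    then show ?thesis using spanV by auto
  qed
  ultimately have "basis A" using A by (simp add: basis_def)
  then have "dim = card A" using A(1) by (intro dim_basis)
  then show ?thesis by (simp add: dim_in_H0_def A_def card_image[OF inj])
qed

lemma h0_eq:
  assumes "n \<ge> 1"
  shows "h0 n (twist n (int d)) = card (monomials n d)"
proof -
  have "h0 n (twist n (int d)) = dim_in_H0 n (twist n (int d)) (twist_sections n (int d) (proj_space n))"
    by (simp add: h0_def dim_in_H0_def H0_def)
  then show ?thesis using dim_in_H0_eq[OF assms subspace_H0_carrier] by (simp add: leading_monomials_H0)
qed

section \<open>The image of the evaluation map\<close>

lemma ev_Nil [simp]: "ev n (twist n d) [] = (\<lambda>x\<in>punctured_space n. 0)"
  by (simp add: ev_def)

lemma ev_Cons [simp]: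
  "ev n (twist n d) ((v, \<phi>) # ts) = (\<lambda>x\<in>punctured_space n. \<phi> (proj_space n) v x + ev n (twist n d) ts x)"
  by (simp add: ev_def)

text \<open>Complex scalars are constant sections of the structure sheaf, so linearity over that
  sheaf gives complex linearity on global sections.\<close>

lemma sheaf_hom_twistD:
  assumes "\<phi> \<in> sheaf_hom n (twist n (int d)) (twist n e)" and v: "v \<in> twist_sections n (int d) (proj_space n)"
  shows "\<phi> (proj_space n) v \<in> twist_sections n e (proj_space n)"
    and "\<phi> (proj_space n) (\<lambda>x\<in>punctured_space n. c * v x) = (\<lambda>x\<in>punctured_space n. c * \<phi> (proj_space n) v x)"
proof -
  have h: "\<phi> (proj_space n) \<in> LinearCombinations.module_hom (structure_ring n (proj_space n))
      (sections (twist n (int d)) (proj_space n)) (sections (twist n e) (proj_space n))"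
    using assms(1) zariski_open_proj_space by (simp add: sheaf_hom_def)
  show "\<phi> (proj_space n) v \<in> twist_sections n e (proj_space n)"
    using module_hom_closed[OF h] v by auto
  show "\<phi> (proj_space n) (\<lambda>x\<in>punctured_space n. c * v x) = (\<lambda>x\<in>punctured_space n. c * \<phi> (proj_space n) v x)"
    using module_hom_smult[OF h, where r = "\<lambda>x\<in>punctured_space n. c" and m = v] v
      twist_sections_const[OF zariski_open_proj_space, where n = n and c = c]
    by (simp add: Union_proj_space cong: restrict_cong)
qed

text \<open>Makes the dimension formula applicable to the image. With tensors as lists, addition is
  concatenation, and a scalar is applied to the first components, which stay in \<open>V\<close>,
  and then pulled out by linearity of the morphisms.\<close>

lemma subspace_ev:
  assumes V: "VectorSpace.subspace complex_field V (H0 n (twist n (int d)))"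
  shows "VectorSpace.subspace complex_field
      (ev n (twist n (int e)) ` tensors V (sheaf_hom n (twist n (int d)) (twist n (int e))))
      (H0 n (twist n (int e)))" (is "VectorSpace.subspace _ (?ev ` tensors V ?\<Phi>) _")
proof (rule subspace_H0I)
  note VD = subspace_H0D[OF V]
  have closed: "?ev ts \<in> twist_sections n (int e) (proj_space n)" if "ts \<in> tensors V ?\<Phi>" for ts
    using that unfolding tensors_def
  proof (induction ts rule: lists.induct)
    case Nil
    then show ?case using subspace_H0D(2)[OF subspace_H0_carrier] by (simp only: ev_Nil)
  next
    case (Cons t ts)
    obtain v \<phi> where t: "t = (v, \<phi>)" "v \<in> V" "\<phi> \<in> ?\<Phi>" using Cons by auto
    have "\<phi> (proj_space n) v \<in> twist_sections n (int e) (proj_space n)"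
      using sheaf_hom_twistD(1)[OF t(3)] t(2) VD(1) by blast
    then show ?case using subspace_H0D(3)[OF subspace_H0_carrier _ Cons.IH] t by (simp only: ev_Cons)
  qed
  then show "?ev ` tensors V ?\<Phi> \<subseteq> twist_sections n (int e) (proj_space n)" by blast
  show "(\<lambda>x\<in>punctured_space n. 0) \<in> ?ev ` tensors V ?\<Phi>"
    by (rule image_eqI[of _ _ "[]"]) (simp_all add: tensors_def)
  have append: "?ev (ts @ us) = (\<lambda>x\<in>punctured_space n. ?ev ts x + ?ev us x)"
    if "us \<in> tensors V ?\<Phi>" for ts us
  proof (induction ts)
    case Nil
    have "?ev us \<in> extensional (punctured_space n)"
      using twist_sections_extensional[OF closed[OF that]] by (simp add: Union_proj_space)
    then show ?case by (simp add: extensional_restrict cong: restrict_cong)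
  next
    case (Cons t ts)
    then show ?case by (cases t) (auto intro!: restrict_ext)
  qed
  show "(\<lambda>x\<in>punctured_space n. f x + g x) \<in> ?ev ` tensors V ?\<Phi>"
    if fg: "f \<in> ?ev ` tensors V ?\<Phi>" "g \<in> ?ev ` tensors V ?\<Phi>" for f g
  proof -
    obtain ts us where "f = ?ev ts" "g = ?ev us" "ts \<in> tensors V ?\<Phi>" "us \<in> tensors V ?\<Phi>"
      using fg by blast
    then show ?thesis by (intro image_eqI[of _ _ "ts @ us"]) (auto simp: append tensors_def)
  qed
  define scale where "scale c ts = map (\<lambda>(v, \<phi>). (\<lambda>x\<in>punctured_space n. c * v x, \<phi>)) ts"
    for c :: complex and ts :: "((vec \<Rightarrow> complex) \<times> (point set \<Rightarrow> (vec \<Rightarrow> complex) \<Rightarrow> vec \<Rightarrow> complex)) list"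
  have scale: "scale c ts \<in> tensors V ?\<Phi> \<and> ?ev (scale c ts) = (\<lambda>x\<in>punctured_space n. c * ?ev ts x)"
    if "ts \<in> tensors V ?\<Phi>" for c ts
    using that unfolding tensors_def
  proof (induction ts rule: lists.induct)
    case Nil
    then show ?case by (auto simp: scale_def intro!: restrict_ext)
  next
    case (Cons t ts)
    obtain v \<phi> where t: "t = (v, \<phi>)" "v \<in> V" "\<phi> \<in> ?\<Phi>" using Cons by auto
    have "v \<in> twist_sections n (int d) (proj_space n)" using t(2) VD(1) by blast
    from sheaf_hom_twistD(2)[OF t(3) this]
    show ?case using Cons.IH t VD(4)[OF t(2)]
      by (auto simp: scale_def distrib_left intro!: restrict_ext)
  qed
  show "(\<lambda>x\<in>punctured_space n. c * f x) \<in> ?ev ` tensors V ?\<Phi>" if f: "f \<in> ?ev ` tensors V ?\<Phi>" for c f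
  proof -
    obtain ts where "f = ?ev ts" "ts \<in> tensors V ?\<Phi>" using f by blast
    then show ?thesis using scale[of ts c] by (intro image_eqI[of _ _ "scale c ts"]) simp_all
  qed
qed

section \<open>Multiplication by forms as morphisms\<close>

definition mult_hom :: "nat \<Rightarrow> int \<Rightarrow> mpoly \<Rightarrow> point set \<Rightarrow> (vec \<Rightarrow> complex) \<Rightarrow> vec \<Rightarrow> complex" where
  "mult_hom n d p = (\<lambda>U\<in>Collect (zariski_open n). \<lambda>s\<in>twist_sections n d U. \<lambda>x\<in>\<Union>U. mpoly_eval p x * s x)"

text \<open>The map is pointwise multiplication by \<open>p\<close>, hence linear and compatible
  with restriction. Its definition restricts both arguments because \<open>sheaf_hom\<close>
  contains only extensional families.\<close>

lemma mult_hom_in_sheaf_hom: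
  assumes p: "homogeneous n e p"
  shows "mult_hom n (int d) p \<in> sheaf_hom n (twist n (int d)) (twist n (int (d + e)))"
proof -
  have closed: "(\<lambda>x\<in>\<Union>U. mpoly_eval p x * s x) \<in> twist_sections n (int (d + e)) U"
    if "zariski_open n U" "s \<in> twist_sections n (int d) U" for U s
    using twist_sections_mult[OF twist_sections_homogeneous[OF that(1) p] that(2)]
    by (simp add: add.commute cong: restrict_cong)
  show ?thesis
    unfolding sheaf_hom_def
  proof (intro CollectI conjI allI impI ballI)
    show "mult_hom n (int d) p \<in> extensional (Collect (zariski_open n))" by (simp add: mult_hom_def)
  next
    fix U assume U: "zariski_open n U"
    show "mult_hom n (int d) p U \<in> extensional (sec (twist n (int d)) U)" using U by (simp add: mult_hom_def)
    have add: "(\<lambda>x\<in>\<Union>U. s x + t x) \<in> twist_sections n (int d) U"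
      if "s \<in> twist_sections n (int d) U" "t \<in> twist_sections n (int d) U" for s t
      using that by (rule twist_sections_add)
    have smult: "(\<lambda>x\<in>\<Union>U. r x * s x) \<in> twist_sections n (int d) U"
      if "r \<in> twist_sections n 0 U" "s \<in> twist_sections n (int d) U" for r s
      using that by (rule twist_sections_smult)
    show "mult_hom n (int d) p U \<in> LinearCombinations.module_hom (structure_ring n U)
        (sections (twist n (int d)) U) (sections (twist n (int (d + e))) U)"
      unfolding LinearCombinations.module_hom_def
      using U by (auto simp: mult_hom_def closed add smult distrib_left mult.left_commute simp del: Union_iff of_nat_add
          intro!: restrict_ext)
  next
    fix U V s assume UV: "zariski_open n U \<and> zariski_open n V \<and> V \<subseteq> U" and s: "s \<in> sec (twist n (int d)) U"
    then have "\<Union>U \<inter> \<Union>V = \<Union>V" by blast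
    then show "restr (twist n (int (d + e))) U V (mult_hom n (int d) p U s)
        = mult_hom n (int d) p V (restr (twist n (int d)) U V s)"
      using UV s twist_sections_restrict[of n V U s "int d"]
      by (auto simp: mult_hom_def intro!: restrict_ext)
  qed
qed

text \<open>A one-element list is enough: multiplying a form of \<open>V\<close> by the monomial
  \<open>u\<close> is the value of \<open>ev\<close> on a pure tensor and shifts the leading
  monomial by \<open>u\<close>.\<close>

lemma leading_monomials_ev:
  "upper_shadow n (leading_monomials (polys_of n d V)) e
    \<subseteq> leading_monomials (polys_of n (d + e)
        (ev n (twist n (int (d + e))) ` tensors V (sheaf_hom n (twist n (int d)) (twist n (int (d + e))))))"
    (is "_ \<subseteq> leading_monomials (polys_of _ _ (?ev ` tensors V ?\<Phi>))")
proof
  fix m assume "m \<in> upper_shadow n (leading_monomials (polys_of n d V)) e"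
  then obtain p u where p: "p \<in> polys_of n d V" "p \<noteq> 0" and u: "u \<in> monomials n e" and m: "m = leading p + u"
    by (auto simp: upper_shadow_def leading_monomials_def)
  let ?u = "Poly_Mapping.single u 1 :: mpoly"
  have hu: "homogeneous n e ?u" using u by (rule homogeneous_single)
  have hp: "homogeneous n d p" "poly_section n p \<in> V" using p by (auto simp: polys_of_def)
  have "poly_section n (p * ?u) = ?ev [(poly_section n p, mult_hom n (int d) ?u)]"
    using poly_section_in_H0[OF hp(1)] zariski_open_proj_space
    by (auto simp: mult_hom_def Union_proj_space poly_section_def mpoly_eval_mult intro!: restrict_ext)
  moreover have "[(poly_section n p, mult_hom n (int d) ?u)] \<in> tensors V ?\<Phi>"
    using hp(2) mult_hom_in_sheaf_hom[OF hu] by (simp add: tensors_def)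
  ultimately have "poly_section n (p * ?u) \<in> ?ev ` tensors V ?\<Phi>" by (rule image_eqI)
  then have "p * ?u \<in> polys_of n (d + e) (?ev ` tensors V ?\<Phi>)"
    using homogeneous_mult[OF hp(1) hu] unfolding polys_of_def by blast
  then show "m \<in> leading_monomials (polys_of n (d + e) (?ev ` tensors V ?\<Phi>))"
    using leading_mult_single[OF p(2), of u] m by (force simp: leading_monomials_def)
qed

section \<open>Stability of the pair\<close>

theorem theorem2p3:
  fixes n :: nat and i j :: int
  assumes "n \<ge> 1" and "i \<ge> 0" and "j > 0"
  shows "strongly_Kronecker_stable n (twist n i) (twist n (i + j))"
proof -
  obtain d where i: "i = int d" using assms(2) nonneg_int_cases by blast
  \<comment> \<open>Positivity of \<open>j\<close> guarantees at least one shadow step, the one that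
    is strict.\<close>
  obtain e where j: "j = int (Suc e)" using assms(3) by (metis gr0_implies_Suc pos_int_cases)
  have ij: "i + j = int (d + Suc e)" using i j by simp
  let ?E1 = "twist n (int d)" and ?E2 = "twist n (int (d + Suc e))"
  let ?\<Phi> = "sheaf_hom n ?E1 ?E2"
  have nonzero: "carrier (H0 n ?E2) \<noteq> {\<zero>\<^bsub>H0 n ?E2\<^esub>}"
  proof
    assume triv: "carrier (H0 n ?E2) = {\<zero>\<^bsub>H0 n ?E2\<^esub>}"
    obtain m where "m \<in> monomials n (d + Suc e)" using monomials_nonempty by blast
    then obtain p where p: "p \<in> polys_of n (d + Suc e) (twist_sections n (int (d + Suc e)) (proj_space n))" "p \<noteq> 0"
      using leading_monomials_H0[of n "d + Suc e"] by (auto simp: leading_monomials_def)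
    then have "poly_section n p = poly_section n 0" using triv by (auto simp: polys_of_def poly_section_0)
    then show False using p poly_section_inj[OF _ homogeneous_0] by (auto simp: polys_of_def)
  qed
  have surj: "ev n ?E2 ` tensors (carrier (H0 n ?E1)) ?\<Phi> = carrier (H0 n ?E2)"
  proof
    note sub = subspace_ev[OF subspace_H0_carrier, where n = n and d = d and e = "d + Suc e"]
    show "ev n ?E2 ` tensors (carrier (H0 n ?E1)) ?\<Phi> \<subseteq> carrier (H0 n ?E2)"
      using subspace_H0D(1)[OF sub] by simp
    \<comment> \<open>Products of monomials of degrees \<open>d\<close> and \<open>Suc e\<close>
      exhaust the higher level, so the image has every possible leading monomial.\<close>
    have "monomials n (d + Suc e) \<subseteq> leading_monomials (polys_of n (d + Suc e)
        (ev n ?E2 ` tensors (twist_sections n (int d) (proj_space n)) ?\<Phi>))"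
      using leading_monomials_ev[of n d "twist_sections n (int d) (proj_space n)" "Suc e"]
      unfolding leading_monomials_H0 upper_shadow_monomials .
    then show "carrier (H0 n ?E2) \<subseteq> ev n ?E2 ` tensors (carrier (H0 n ?E1)) ?\<Phi>"
      using subspace_mono_leading[OF assms(1) sub subspace_H0_carrier subspace_H0D(1)[OF sub]]
      by (simp only: leading_monomials_H0 H0_twist_simps)
  qed
  have ineq: "real (dim_in_H0 n ?E2 (ev n ?E2 ` tensors V ?\<Phi>)) / real (h0 n ?E2)
      > real (dim_in_H0 n ?E1 V) / real (h0 n ?E1)"
    if V: "VectorSpace.subspace complex_field V (H0 n ?E1)"
      and nz: "V \<noteq> {\<zero>\<^bsub>H0 n ?E1\<^esub>}" and proper: "V \<noteq> carrier (H0 n ?E1)" for V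
  proof -
    let ?L = "leading_monomials (polys_of n d V)"
    let ?W = "ev n ?E2 ` tensors V ?\<Phi>"
    note W = subspace_ev[OF V, of "d + Suc e"]
    have L: "?L \<subseteq> monomials n d" by (rule leading_monomials_subset[OF polys_of_homogeneous])
    have "?L \<noteq> {}"
    proof -
      obtain f where f: "f \<in> V" "f \<noteq> (\<lambda>x\<in>punctured_space n. 0)" using nz subspace_H0D(2)[OF V] by auto
      obtain p where "p \<in> polys_of n d V" "f = poly_section n p"
        using polys_of_section[OF assms(1) subspace_H0D(1)[OF V] f(1)] by blast
      moreover have "p \<noteq> 0" using f(2) calculation(2) poly_section_0 by auto
      ultimately show ?thesis by (auto simp: leading_monomials_def)
    qed
    \<comment> \<open>A full set of leading monomials would force \<open>V\<close> to be the whole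
      space.\<close>
    moreover have "?L \<noteq> monomials n d"
      using subspace_mono_leading[OF assms(1) V subspace_H0_carrier subspace_H0D(1)[OF V]] proper
        subspace_H0D(1)[OF V] by (auto simp: leading_monomials_H0)
    ultimately have "real (card ?L) / card (monomials n d)
        < card (upper_shadow n ?L (Suc e)) / card (monomials n (d + Suc e))"
      by (intro upper_shadow_density L)
    \<comment> \<open>The image may have further leading monomials; that only increases the
      right-hand side.\<close>
    also have "\<dots> \<le> card (leading_monomials (polys_of n (d + Suc e) ?W)) / card (monomials n (d + Suc e))"
    proof -
      have "finite (leading_monomials (polys_of n (d + Suc e) ?W))"
        by (rule finite_subset[OF leading_monomials_subset[OF polys_of_homogeneous] finite_monomials])
      then show ?thesis
        by (intro divide_right_mono of_nat_mono card_mono leading_monomials_ev) simp_all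
    qed
    finally show ?thesis
      by (simp only: dim_in_H0_eq[OF assms(1) V] dim_in_H0_eq[OF assms(1) W] h0_eq[OF assms(1)])
  qed
  show ?thesis
    unfolding strongly_Kronecker_stable_def ij unfolding i
    using nonzero surj ineq by (intro conjI coherent_twist allI impI) (simp_all only: simp_thms)
qed

end
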